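(* Let $P$ be a submonoid of a group $G$, with group of units $P^*=P\cap P^{-1}$. Every nontrivial (that is, nonzero) ideal of $\mathcal T_\lambda(P)\cong D_r\rtimes_{\gamma,r}G$ has nontrivial (nonzero) intersection with the subalgebra $D_r\rtimes_{\gamma,r}P^*$. In other words, a representation of $\mathcal T_\lambda(P)$ is faithful if and only if it is faithful on $D_r\rtimes_{\gamma,r}P^*$.
   Context: $P$ is a submonoid of a group $G$ with identity $e$. Ideals of $\mathrm C^*$-algebras are closed and two-sided. $L_p\delta_q=\delta_{pq}$ defines the left regular representation of $P$ by isometries on $\ell^2(P)$, and $\mathcal T_\lambda(P)$ is the $\mathrm C^*$-algebra generated by $\{L_p:p\in P\}$. A word is a finite sequence $\alpha=(p_1,p_2,\ldots,p_{2k-1},p_{2k})$ of even length $2k\ge 0$ with entries in $P$; $\mathcal W$ is the set of all words (including the empty word). Put $\dot\alpha:=p_1^{-1}p_2\cdots p_{2k-1}^{-1}p_{2k}\in G$ (equal to $e$ for the empty word), $\tilde\alpha:=(p_{2k},p_{2k-1},\ldots,p_2,p_1)$, and $K(\alpha):=P\cap p_{2k}^{-1}p_{2k-1}P\cap p_{2k}^{-1}p_{2k-1}p_{2k-2}^{-1}p_{2k-3}P\cap\cdots\cap p_{2k}^{-1}p_{2k-1}\cdots p_2^{-1}p_1P$ (equal to $P$ for the empty word). $D_r:=\overline{\mathrm{span}}\{\mathbb 1_{K(\alpha)}:\alpha\in\mathcal W,\dot\alpha=e\}\subseteq\ell^\infty(P)$ (characteristic functions acting on $\ell^2(P)$ by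 multiplication) is a $\mathrm C^*$-subalgebra of $\mathcal T_\lambda(P)$. Partial action: for $g\in G$ let $A_{g^{-1}}:=\overline{\mathrm{span}}\{\mathbb 1_{K(\alpha)}:\alpha\in\mathcal W,\dot\alpha=g\}$, a closed ideal of $D_r$, and let $\gamma_g\colon A_{g^{-1}}\to A_g$ be the $*$-isomorphism with $\gamma_g(\mathbb 1_{K(\alpha)})=\mathbb 1_{gK(\alpha)}=\mathbb 1_{K(\tilde\alpha)}$ for $\dot\alpha=g$. The reduced partial crossed product $D_r\rtimes_{\gamma,r}G$ is the reduced cross-sectional $\mathrm C^*$-algebra of the Fell bundle with fibers $A_g\delta_g$, multiplication $(a\delta_g)(b\delta_h)=\gamma_g(\gamma_{g^{-1}}(a)b)\delta_{gh}$ and involution $(a\delta_g)^*=\gamma_{g^{-1}}(a^* )\delta_{g^{-1}}$. There is an isomorphism $\mathcal T_\lambda(P)\cong D_r\rtimes_{\gamma,r}G$ with $L_p\mapsto\mathbb 1_{pP}\delta_p$, used as an identification. For $u\in P^*$ one has $A_u=D_r$, so $\gamma$ restricts to an action of the group $P^*$ on $D_r$ by automorphisms; its reduced crossed product $D_r\rtimes_{\gamma,r}P^*$ embeds canonically in $D_r\rtimes_{\gamma,r}G$ as the closed linear span of $\{a\delta_u:a\in D_r,u\in P^*\}$, i.e. as the $\mathrm C^*$-subalgebra of $\mathcal T_\lambda(P)$ generated by $D_r$ and $\{L_u:u\in P^*\}$. *)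

theory Defs
  imports "HOL-Analysis.Analysis" "HOL-Algebra.Coset"
begin

section \<open>Complex Hilbert spaces\<close>

text \<open>HOL-Analysis only has real inner products.  The inner product below is linear in the
  first and conjugate-linear in the second argument; its positivity is part of
  \<open>cinner_self\<close>.\<close>

class complex_hilbert_space = banach +
  fixes scaleC :: "complex \<Rightarrow> 'a \<Rightarrow> 'a"
    and cinner :: "'a \<Rightarrow> 'a \<Rightarrow> complex"
  assumes scaleC_add_right: "scaleC c (x + y) = scaleC c x + scaleC c y"
    and scaleC_add_left: "scaleC (c + d) x = scaleC c x + scaleC d x"
    and scaleC_scaleC: "scaleC c (scaleC d x) = scaleC (c * d) x"
    and scaleR_scaleC: "scaleR r x = scaleC (complex_of_real r) x"
    and cinner_add_left: "cinner (x + y) z = cinner x z + cinner y z"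
    and cinner_scaleC_left: "cinner (scaleC c x) y = c * cinner x y"
    and cinner_commute: "cinner x y = cnj (cinner y x)"
    and cinner_self: "cinner x x = complex_of_real ((norm x)\<^sup>2)"

lemma norm_scaleC: "norm (scaleC c x) = cmod c * norm (x :: 'a::complex_hilbert_space)"
proof -
  have "cinner (scaleC c x) (scaleC c x) = c * cnj c * cinner x x"
    using cinner_scaleC_left[of c x "scaleC c x"] cinner_scaleC_left[of c x x]
      cinner_commute[of x "scaleC c x"] cinner_commute[of x x]
    by simp
  also have "\<dots> = complex_of_real ((cmod c * norm x)\<^sup>2)"
    by (simp add: cinner_self power_mult_distrib complex_norm_square[symmetric] 
        del: of_real_power)
  finally have "(norm (scaleC c x))\<^sup>2 = (cmod c * norm x)\<^sup>2"
    unfolding cinner_self of_real_eq_iff .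
  then show ?thesis
    by (simp add: power2_eq_iff_nonneg)
qed

lemma bounded_linear_scaleC: "bounded_linear (scaleC c :: 'a \<Rightarrow> 'a::complex_hilbert_space)"
proof (rule bounded_linear_intro)
  show "scaleC c (r *\<^sub>R x) = r *\<^sub>R scaleC c x" for r and x :: 'a
    by (simp add: scaleR_scaleC scaleC_scaleC mult.commute)
  show "norm (scaleC c x) \<le> norm x * cmod c" for x :: 'a
    by (simp add: norm_scaleC)
qed (rule scaleC_add_right)


section \<open>Square-summable functions\<close>

definition square_summable :: "('a \<Rightarrow> complex) \<Rightarrow> bool"
  where "square_summable f \<longleftrightarrow> (\<lambda>x. (cmod (f x))\<^sup>2) summable_on UNIV"

definition norm2 :: "('a \<Rightarrow> complex) \<Rightarrow> real"
  where "norm2 f = sqrt (\<Sum>\<^sub>\<infinity>x. (cmod (f x))\<^sup>2)"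

lemma square_summableI:
  assumes "\<And>F. finite F \<Longrightarrow> L2_set (\<lambda>x. cmod (f x)) F \<le> B"
  shows "square_summable f" and "norm2 f \<le> B"
proof -
  have B0: "B \<ge> 0"
    using assms[of "{}"] by simp
  have le: "(\<Sum>x\<in>F. (cmod (f x))\<^sup>2) \<le> B\<^sup>2" if "finite F" for F
    using assms[OF that] unfolding L2_set_def
    by (meson real_sqrt_le_iff sqrt_le_D)
  show s: "square_summable f"
    unfolding square_summable_def
    by (rule nonneg_bounded_partial_sums_imp_summable_on[where C = "B\<^sup>2"])
      (auto simp: eventually_finite_subsets_at_top intro!: exI[of _ "{}"] le)
  have "(\<Sum>\<^sub>\<infinity>x. (cmod (f x))\<^sup>2) \<le> B\<^sup>2"
    using s unfolding square_summable_def
    by (rule infsum_le_finite_sums) (auto intro: le)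
  then show "norm2 f \<le> B"
    unfolding norm2_def using B0 by (simp add: real_le_lsqrt)
qed

lemma L2_set_le_norm2:
  assumes "square_summable f" "finite F"
  shows "L2_set (\<lambda>x. cmod (f x)) F \<le> norm2 f"
  unfolding norm2_def L2_set_def
  using finite_sum_le_infsum[of "\<lambda>x. (cmod (f x))\<^sup>2" UNIV F] assms
  by (simp add: square_summable_def)

lemma norm2_nonneg: "norm2 f \<ge> 0"
  unfolding norm2_def by (simp add: infsum_nonneg)

lemma norm2_power2: "(norm2 f)\<^sup>2 = (\<Sum>\<^sub>\<infinity>x. (cmod (f x))\<^sup>2)"
  unfolding norm2_def by (simp add: infsum_nonneg)

lemma cmod_le_norm2: "square_summable f \<Longrightarrow> cmod (f x) \<le> norm2 f"
  using L2_set_le_norm2[of f "{x}"] by simp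

lemma square_summable_zero: "square_summable (\<lambda>_. 0)"
  by (simp add: square_summable_def)

lemma
  assumes "square_summable f" "square_summable g"
  shows square_summable_add: "square_summable (\<lambda>x. f x + g x)"
    and norm2_triangle: "norm2 (\<lambda>x. f x + g x) \<le> norm2 f + norm2 g"
proof -
  have "L2_set (\<lambda>x. cmod (f x + g x)) F \<le> norm2 f + norm2 g" if "finite F" for F
  proof -
    have "L2_set (\<lambda>x. cmod (f x + g x)) F \<le> L2_set (\<lambda>x. cmod (f x) + cmod (g x)) F"
      by (rule L2_set_mono) (auto intro: norm_triangle_ineq)
    also have "\<dots> \<le> L2_set (\<lambda>x. cmod (f x)) F + L2_set (\<lambda>x. cmod (g x)) F"
      by (rule L2_set_triangle_ineq)
    also have "\<dots> \<le> norm2 f + norm2 g"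
      by (intro add_mono L2_set_le_norm2 assms that)
    finally show ?thesis .
  qed
  from square_summableI[OF this]
  show "square_summable (\<lambda>x. f x + g x)" "norm2 (\<lambda>x. f x + g x) \<le> norm2 f + norm2 g"
    by auto
qed

lemma square_summable_cmult:
  assumes "square_summable f"
  shows "square_summable (\<lambda>x. c * f x)"
  using assms unfolding square_summable_def
  by (simp add: norm_mult power_mult_distrib summable_on_cmult_right)

lemma norm2_cmult: "norm2 (\<lambda>x. c * f x) = cmod c * norm2 f"
  unfolding norm2_def
  by (simp add: norm_mult power_mult_distrib infsum_cmult_right' real_sqrt_mult)

lemma square_summable_diff:
  assumes "square_summable f" "square_summable g"
  shows "square_summable (\<lambda>x. f x - g x)"
  using square_summable_add[OF assms(1) square_summable_cmult[OF assms(2), of "-1"]] by simp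

lemma summable_on_mult_cnj:
  assumes "square_summable f" "square_summable g"
  shows "(\<lambda>x. f x * cnj (g x)) summable_on UNIV"
proof (rule abs_summable_summable, rule Infinite_Sum.abs_summable_on_comparison_test)
  show "(\<lambda>x. norm ((cmod (f x))\<^sup>2 + (cmod (g x))\<^sup>2)) summable_on UNIV"
    using assms unfolding square_summable_def by (simp add: summable_on_add)
  show "norm (f x * cnj (g x)) \<le> norm ((cmod (f x))\<^sup>2 + (cmod (g x))\<^sup>2)" for x
  proof -
    have "0 \<le> (cmod (f x) - cmod (g x))\<^sup>2" by simp
    moreover have "0 \<le> cmod (f x) * cmod (g x)" by simp
    ultimately have "cmod (f x) * cmod (g x) \<le> (cmod (f x))\<^sup>2 + (cmod (g x))\<^sup>2"
      unfolding power2_diff by linarith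
    then show ?thesis by (simp add: norm_mult)
  qed
qed

lemma infsum_mult_cnj_self:
  assumes "square_summable f"
  shows "(\<Sum>\<^sub>\<infinity>x. f x * cnj (f x)) = complex_of_real ((norm2 f)\<^sup>2)"
proof (rule infsumI)
  have "((\<lambda>x. (cmod (f x))\<^sup>2) has_sum (norm2 f)\<^sup>2) UNIV"
    using assms unfolding norm2_power2 square_summable_def by (rule has_sum_infsum)
  from has_sum_of_real[OF this, where 'a = complex]
  show "((\<lambda>x. f x * cnj (f x)) has_sum complex_of_real ((norm2 f)\<^sup>2)) UNIV"
    by (simp only: complex_norm_square)
qed

lemma norm2_eq_0_iff:
  assumes "square_summable f"
  shows "norm2 f = 0 \<longleftrightarrow> f = (\<lambda>_. 0)"
proof
  assume "norm2 f = 0"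
  then show "f = (\<lambda>_. 0)" using cmod_le_norm2[OF assms] by auto
qed (simp add: norm2_def)

lemma square_summable_complete:
  fixes X :: "nat \<Rightarrow> 'a \<Rightarrow> complex"
  assumes ss: "\<And>n. square_summable (X n)"
    and C: "\<And>e. e > 0 \<Longrightarrow> \<exists>M. \<forall>m\<ge>M. \<forall>n\<ge>M. norm2 (\<lambda>x. X m x - X n x) < e"
  shows "\<exists>l. square_summable l \<and> (\<forall>e>0. \<exists>M. \<forall>n\<ge>M. norm2 (\<lambda>x. X n x - l x) < e)"
proof -
  have "Cauchy (\<lambda>n. X n x)" for x
  proof (rule metric_CauchyI)
    fix e :: real assume "e > 0"
    then obtain M where "\<forall>m\<ge>M. \<forall>n\<ge>M. norm2 (\<lambda>x. X m x - X n x) < e"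
      using C by blast
    then show "\<exists>M. \<forall>m\<ge>M. \<forall>n\<ge>M. dist (X m x) (X n x) < e"
      by (metis (no_types, lifting) cmod_le_norm2[OF square_summable_diff[OF ss ss]]
          dist_norm order_le_less_trans)
  qed
  then have "\<forall>x. \<exists>z. (\<lambda>n. X n x) \<longlonglongrightarrow> z"
    by (simp add: Cauchy_convergent_iff convergent_def)
  then obtain l where l: "\<And>x. (\<lambda>n. X n x) \<longlonglongrightarrow> l x" by metis
  have key: "L2_set (\<lambda>x. cmod (X n x - l x)) F \<le> e"
    if "finite F" "n \<ge> M" and M: "\<forall>m\<ge>M. \<forall>n\<ge>M. norm2 (\<lambda>x. X m x - X n x) < e" for F n M e
  proof (rule LIMSEQ_le_const2)
    show "(\<lambda>m. L2_set (\<lambda>x. cmod (X n x - X m x)) F) \<longlonglongrightarrow> L2_set (\<lambda>x. cmod (X n x - l x)) F"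
      unfolding L2_set_def by (intro tendsto_intros l)
    have "L2_set (\<lambda>x. cmod (X n x - X m x)) F \<le> e" if "m \<ge> M" for m
      using L2_set_le_norm2[OF square_summable_diff[OF ss ss] \<open>finite F\<close>, of n m]
        M \<open>n \<ge> M\<close> that by fastforce
    then show "\<exists>N. \<forall>m\<ge>N. L2_set (\<lambda>x. cmod (X n x - X m x)) F \<le> e" by blast
  qed
  obtain M1 where M1: "\<forall>m\<ge>M1. \<forall>n\<ge>M1. norm2 (\<lambda>x. X m x - X n x) < 1"
    using C[of 1] by auto
  have "square_summable (\<lambda>x. X M1 x - l x)"
    by (rule square_summableI(1)[where B = 1]) (rule key[OF _ order_refl M1])
  from square_summable_diff[OF ss[of M1] this] have "square_summable l" by simp
  moreover have "\<exists>M. \<forall>n\<ge>M. norm2 (\<lambda>x. X n x - l x) < e" if "e > 0" for e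
  proof -
    obtain M where M: "\<forall>m\<ge>M. \<forall>n\<ge>M. norm2 (\<lambda>x. X m x - X n x) < e / 2"
      using C[of "e / 2"] \<open>e > 0\<close> half_gt_zero by blast
    have "norm2 (\<lambda>x. X n x - l x) \<le> e / 2" if "n \<ge> M" for n
      by (rule square_summableI(2)) (rule key[OF _ that M])
    then show ?thesis using \<open>e > 0\<close> by (intro exI[of _ M]) fastforce
  qed
  ultimately show ?thesis by blast
qed


section \<open>The Hilbert space of square-summable functions\<close>

typedef 'a ell2 = "{f :: 'a \<Rightarrow> complex. square_summable f}"
  morphisms coord Abs_ell2
  using square_summable_zero by blast

setup_lifting type_definition_ell2

lemma square_summable_coord: "square_summable (coord x)"
  using coord by blast

instantiation ell2 :: (type) real_normed_vector
begin

lift_definition zero_ell2 :: "'a ell2" is "\<lambda>_. 0"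
  by (rule square_summable_zero)

lift_definition plus_ell2 :: "'a ell2 \<Rightarrow> 'a ell2 \<Rightarrow> 'a ell2" is "\<lambda>f g x. f x + g x"
  by (rule square_summable_add)

lift_definition minus_ell2 :: "'a ell2 \<Rightarrow> 'a ell2 \<Rightarrow> 'a ell2" is "\<lambda>f g x. f x - g x"
  by (rule square_summable_diff)

lift_definition uminus_ell2 :: "'a ell2 \<Rightarrow> 'a ell2" is "\<lambda>f x. - f x"
  by (simp add: square_summable_def)

lift_definition scaleR_ell2 :: "real \<Rightarrow> 'a ell2 \<Rightarrow> 'a ell2" is "\<lambda>r f x. complex_of_real r * f x"
  by (rule square_summable_cmult)

lift_definition norm_ell2 :: "'a ell2 \<Rightarrow> real" is norm2 .

definition dist_ell2 :: "'a ell2 \<Rightarrow> 'a ell2 \<Rightarrow> real"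
  where "dist_ell2 x y = norm (x - y)"

definition sgn_ell2 :: "'a ell2 \<Rightarrow> 'a ell2"
  where "sgn_ell2 x = inverse (norm x) *\<^sub>R x"

definition uniformity_ell2 :: "('a ell2 \<times> 'a ell2) filter"
  where "uniformity_ell2 = (INF e\<in>{0 <..}. principal {(x, y). dist x y < e})"

definition open_ell2 :: "'a ell2 set \<Rightarrow> bool"
  where "open_ell2 U \<longleftrightarrow> (\<forall>x\<in>U. eventually (\<lambda>(x', y). x' = x \<longrightarrow> y \<in> U) uniformity)"

instance
proof
  fix x y z :: "'a ell2" and r s :: real
  show "x + y + z = x + (y + z)" by transfer (simp add: add.assoc)
  show "x + y = y + x" by transfer (simp add: add.commute)
  show "0 + x = x" by transfer simp
  show "- x + x = 0" by transfer simp
  show "x - y = x + - y" by transfer simp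
  show "r *\<^sub>R (x + y) = r *\<^sub>R x + r *\<^sub>R y" by transfer (simp add: algebra_simps)
  show "(r + s) *\<^sub>R x = r *\<^sub>R x + s *\<^sub>R x" by transfer (simp add: algebra_simps)
  show "r *\<^sub>R s *\<^sub>R x = (r * s) *\<^sub>R x" by transfer (simp add: algebra_simps)
  show "1 *\<^sub>R x = x" by transfer simp
  show "dist x y = norm (x - y)" by (rule dist_ell2_def)
  show "sgn x = inverse (norm x) *\<^sub>R x" by (rule sgn_ell2_def)
  show "uniformity = (INF e\<in>{0 <..}. principal {(x, y :: 'a ell2). dist x y < e})"
    by (rule uniformity_ell2_def)
  show "open U \<longleftrightarrow> (\<forall>x\<in>U. \<forall>\<^sub>F (x', y) in uniformity. x' = x \<longrightarrow> y \<in> U)" for U :: "'a ell2 set"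
    by (rule open_ell2_def)
  show "norm x = 0 \<longleftrightarrow> x = 0" by transfer (rule norm2_eq_0_iff)
  show "norm (x + y) \<le> norm x + norm y" by transfer (rule norm2_triangle)
  show "norm (r *\<^sub>R x) = \<bar>r\<bar> * norm x" by transfer (simp add: norm2_cmult)
qed

end

instance ell2 :: (type) banach
proof
  fix X :: "nat \<Rightarrow> 'a ell2" assume C: "Cauchy X"
  have "\<exists>M. \<forall>m\<ge>M. \<forall>n\<ge>M. norm2 (\<lambda>x. coord (X m) x - coord (X n) x) < e" if "e > 0" for e
    using CauchyD[OF C that] unfolding norm_ell2.rep_eq minus_ell2.rep_eq .
  from square_summable_complete[OF square_summable_coord this]
  obtain l where l: "square_summable l"
    and lim: "\<And>e. e > 0 \<Longrightarrow> \<exists>M. \<forall>n\<ge>M. norm2 (\<lambda>x. coord (X n) x - l x) < e"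
    by auto
  have "X \<longlonglongrightarrow> Abs_ell2 l"
    using lim l
    by (intro LIMSEQ_I) (simp add: norm_ell2.rep_eq minus_ell2.rep_eq Abs_ell2_inverse)
  then show "convergent X" by (rule convergentI)
qed

instantiation ell2 :: (type) complex_hilbert_space
begin

lift_definition scaleC_ell2 :: "complex \<Rightarrow> 'a ell2 \<Rightarrow> 'a ell2" is "\<lambda>c f x. c * f x"
  by (rule square_summable_cmult)

lift_definition cinner_ell2 :: "'a ell2 \<Rightarrow> 'a ell2 \<Rightarrow> complex"
  is "\<lambda>f g. \<Sum>\<^sub>\<infinity>x. f x * cnj (g x)" .

instance
proof
  fix x y z :: "'a ell2" and r :: real and c d :: complex
  show "scaleC c (x + y) = scaleC c x + scaleC c y" by transfer (simp add: algebra_simps)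
  show "scaleC (c + d) x = scaleC c x + scaleC d x" by transfer (simp add: algebra_simps)
  show "scaleC c (scaleC d x) = scaleC (c * d) x" by transfer (simp add: algebra_simps)
  show "r *\<^sub>R x = scaleC (complex_of_real r) x" by transfer simp
  show "cinner (x + y) z = cinner x z + cinner y z"
    by transfer (simp add: ring_distribs infsum_add summable_on_mult_cnj)
  show "cinner (scaleC c x) y = c * cinner x y"
    by transfer (simp add: mult.assoc infsum_cmult_right')
  show "cinner x y = cnj (cinner y x)"
    by transfer (simp add: mult.commute flip: infsum_cnj)
  show "cinner x x = complex_of_real ((norm x)\<^sup>2)"
    by transfer (rule infsum_mult_cnj_self)
qed

end

lift_definition ket :: "'a \<Rightarrow> 'a ell2" is "\<lambda>a x. if x = a then 1 else 0"
proof -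
  fix a :: 'a
  have "(\<lambda>x. (cmod (if x = a then 1 else 0))\<^sup>2) summable_on {a}" by simp
  then show "square_summable (\<lambda>x. if x = a then 1 else 0)"
    unfolding square_summable_def
    by (rule summable_on_cong_neutral[THEN iffD1, rotated -1]) auto
qed


section \<open>Operator algebras\<close>

definition bounded_operators :: "('h::complex_hilbert_space \<Rightarrow>\<^sub>L 'h) set"
  where "bounded_operators = {T :: 'h \<Rightarrow>\<^sub>L 'h. \<forall>c x. T (scaleC c x) = scaleC c (T x)}"

definition scaleC_op ::
  "complex \<Rightarrow> ('h::complex_hilbert_space \<Rightarrow>\<^sub>L 'h) \<Rightarrow> 'h \<Rightarrow>\<^sub>L 'h"
  where "scaleC_op c T = Blinfun (scaleC c) o\<^sub>L T"

lemma scaleC_op_apply [simp]: "scaleC_op c T x = scaleC c (T x)"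
  by (simp add: scaleC_op_def bounded_linear_Blinfun_apply bounded_linear_scaleC)

text \<open>\<open>S\<close> is the adjoint of \<open>T\<close>.  Adjoints are unique, and exist for complex-linear \<open>T\<close> by the
  Riesz representation theorem; the relational form avoids needing this for the definitions.\<close>

definition is_adjoint :: "('h::complex_hilbert_space \<Rightarrow>\<^sub>L 'h) \<Rightarrow> ('h \<Rightarrow>\<^sub>L 'h) \<Rightarrow> bool"
  where "is_adjoint S T \<longleftrightarrow> (\<forall>x y. cinner (T x) y = cinner x (S y))"

definition op_subspace :: "('h::complex_hilbert_space \<Rightarrow>\<^sub>L 'h) set \<Rightarrow> bool"
  where "op_subspace V \<longleftrightarrow> V \<subseteq> bounded_operators \<and> 0 \<in> V \<and>
    (\<forall>S\<in>V. \<forall>T\<in>V. S + T \<in> V) \<and> (\<forall>c. \<forall>T\<in>V. scaleC_op c T \<in> V)"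

text \<open>The topology on \<open>'h \<Rightarrow>\<^sub>L 'h\<close>, hence \<open>closed\<close>, is that of the operator norm.\<close>

definition cstar_algebra :: "('h::complex_hilbert_space \<Rightarrow>\<^sub>L 'h) set \<Rightarrow> bool"
  where "cstar_algebra A \<longleftrightarrow> op_subspace A \<and> closed A \<and>
    (\<forall>S\<in>A. \<forall>T\<in>A. S o\<^sub>L T \<in> A) \<and> (\<forall>S. \<forall>T\<in>A. is_adjoint S T \<longrightarrow> S \<in> A)"

definition closed_ideal ::
  "('h::complex_hilbert_space \<Rightarrow>\<^sub>L 'h) set \<Rightarrow> ('h \<Rightarrow>\<^sub>L 'h) set \<Rightarrow> bool"
  where "closed_ideal A I \<longleftrightarrow> I \<subseteq> A \<and> op_subspace I \<and> closed I \<and>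
    (\<forall>S\<in>A. \<forall>T\<in>I. S o\<^sub>L T \<in> I \<and> T o\<^sub>L S \<in> I)"

text \<open>A representation is a \<open>*\<close>-homomorphism into the bounded operators of a Hilbert space; it
  need not be nondegenerate.\<close>

definition cstar_representation ::
  "('h::complex_hilbert_space \<Rightarrow>\<^sub>L 'h) set \<Rightarrow>
    (('h \<Rightarrow>\<^sub>L 'h) \<Rightarrow> ('k::complex_hilbert_space \<Rightarrow>\<^sub>L 'k)) \<Rightarrow> bool"
  where "cstar_representation A \<pi> \<longleftrightarrow> \<pi> ` A \<subseteq> bounded_operators \<and>
    (\<forall>S\<in>A. \<forall>T\<in>A. \<pi> (S + T) = \<pi> S + \<pi> T \<and> \<pi> (S o\<^sub>L T) = \<pi> S o\<^sub>L \<pi> T) \<and>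
    (\<forall>c. \<forall>T\<in>A. \<pi> (scaleC_op c T) = scaleC_op c (\<pi> T)) \<and>
    (\<forall>S\<in>A. \<forall>T\<in>A. is_adjoint S T \<longrightarrow> is_adjoint (\<pi> S) (\<pi> T))"

abbreviation faithful_on ::
  "('h::complex_hilbert_space \<Rightarrow>\<^sub>L 'h) set \<Rightarrow>
    (('h \<Rightarrow>\<^sub>L 'h) \<Rightarrow> ('k::complex_hilbert_space \<Rightarrow>\<^sub>L 'k)) \<Rightarrow> bool"
  where "faithful_on A \<pi> \<equiv> inj_on \<pi> A"


section \<open>The Toeplitz algebra of a submonoid\<close>

text \<open>For a submonoid \<open>P\<close> of a group \<open>G\<close> on the type \<open>'g\<close>, the Hilbert space \<open>\<ell>\<^sup>2(P)\<close> is the closed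
  subspace of \<open>'g ell2\<close> of functions vanishing off \<open>P\<close>.  An operator on \<open>\<ell>\<^sup>2(P)\<close> is represented by
  its extension by zero on the orthogonal complement of \<open>\<ell>\<^sup>2(P)\<close>; this identifies the bounded
  operators of \<open>\<ell>\<^sup>2(P)\<close> isometrically, as a \<open>*\<close>-algebra, with a corner of those of \<open>'g ell2\<close>.
  The unit of the corner is the projection onto \<open>\<ell>\<^sup>2(P)\<close>, not the identity.\<close>

definition isometry_fun ::
  "('g, 'm) monoid_scheme \<Rightarrow> 'g set \<Rightarrow> 'g \<Rightarrow> ('g \<Rightarrow> complex) \<Rightarrow> 'g \<Rightarrow> complex"
  where "isometry_fun G P p f = (\<lambda>x. if x \<in> p <#\<^bsub>G\<^esub> P then f (inv\<^bsub>G\<^esub> p \<otimes>\<^bsub>G\<^esub> x) else 0)"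

definition left_regular :: "('g, 'm) monoid_scheme \<Rightarrow> 'g set \<Rightarrow> 'g \<Rightarrow> 'g ell2 \<Rightarrow>\<^sub>L 'g ell2"
  where "left_regular G P p = Blinfun (\<lambda>\<xi>. Abs_ell2 (isometry_fun G P p (coord \<xi>)))"

definition toeplitz_algebra :: "('g, 'm) monoid_scheme \<Rightarrow> 'g set \<Rightarrow> ('g ell2 \<Rightarrow>\<^sub>L 'g ell2) set"
  where "toeplitz_algebra G P = cstar_algebra hull (left_regular G P ` P)"

text \<open>The word \<open>(p\<^sub>1, p\<^sub>2, \<dots>, p\<^sub>2\<^sub>k\<^sub>-\<^sub>1, p\<^sub>2\<^sub>k)\<close> is the list of pairs
  \<open>[(p\<^sub>1, p\<^sub>2), \<dots>, (p\<^sub>2\<^sub>k\<^sub>-\<^sub>1, p\<^sub>2\<^sub>k)]\<close>.\<close>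

type_synonym 'g word = "('g \<times> 'g) list"

definition words :: "'g set \<Rightarrow> 'g word set"
  where "words P = lists (P \<times> P)"

primrec word_val :: "('g, 'm) monoid_scheme \<Rightarrow> 'g word \<Rightarrow> 'g"
  where
    "word_val G [] = \<one>\<^bsub>G\<^esub>"
  | "word_val G (pq # \<alpha>) = inv\<^bsub>G\<^esub> (fst pq) \<otimes>\<^bsub>G\<^esub> snd pq \<otimes>\<^bsub>G\<^esub> word_val G \<alpha>"

text \<open>The inverse of the value of \<open>(p\<^sub>1, \<dots>, p\<^sub>2\<^sub>k)\<close> is \<open>p\<^sub>2\<^sub>k\<^sup>-\<^sup>1 p\<^sub>2\<^sub>k\<^sub>-\<^sub>1 \<cdots> p\<^sub>2\<^sup>-\<^sup>1 p\<^sub>1\<close>, so the last set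
  of the intersection defining \<open>K(\<alpha>)\<close> is the translate of \<open>P\<close> by the inverse of the value of
  \<open>\<alpha>\<close>; the others belong to the proper suffixes of \<open>\<alpha>\<close>.\<close>

primrec constructible :: "('g, 'm) monoid_scheme \<Rightarrow> 'g set \<Rightarrow> 'g word \<Rightarrow> 'g set"
  where
    "constructible G P [] = P"
  | "constructible G P (pq # \<alpha>) =
      constructible G P \<alpha> \<inter> (inv\<^bsub>G\<^esub> (word_val G (pq # \<alpha>)) <#\<^bsub>G\<^esub> P)"

text \<open>Multiplication by the characteristic function of \<open>X\<close>.\<close>

definition mult_indicator :: "'g set \<Rightarrow> 'g ell2 \<Rightarrow>\<^sub>L 'g ell2"
  where "mult_indicator X = Blinfun (\<lambda>\<xi>. Abs_ell2 (\<lambda>x. indicator X x * coord \<xi> x))"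

text \<open>\<open>D\<^sub>r\<close> as an algebra of multiplication operators; the action of bounded functions by
  multiplication is isometric, so the norm closure is that of \<open>\<ell>\<^sup>\<infinity>(P)\<close>.\<close>

definition diagonal_algebra :: "('g, 'm) monoid_scheme \<Rightarrow> 'g set \<Rightarrow> ('g ell2 \<Rightarrow>\<^sub>L 'g ell2) set"
  where "diagonal_algebra G P = closure (op_subspace hull
    {mult_indicator (constructible G P \<alpha>) | \<alpha>. \<alpha> \<in> words P \<and> word_val G \<alpha> = \<one>\<^bsub>G\<^esub>})"

definition unit_group :: "('g, 'm) monoid_scheme \<Rightarrow> 'g set \<Rightarrow> 'g set"
  where "unit_group G P = P \<inter> set_inv\<^bsub>G\<^esub> P"

text \<open>\<open>D\<^sub>r \<rtimes>\<^sub>\<gamma>\<^sub>,\<^sub>r P\<^sup>*\<close> inside the Toeplitz algebra.  Under the identification of the Toeplitz algebra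
  with \<open>D\<^sub>r \<rtimes>\<^sub>\<gamma>\<^sub>,\<^sub>r G\<close>, which sends \<open>L\<^sub>p\<close> to \<open>1\<^sub>p\<^sub>P \<delta>\<^sub>p\<close>, the element \<open>a \<delta>\<^sub>u\<close> with \<open>a\<close> in \<open>D\<^sub>r\<close> and \<open>u\<close> in
  \<open>P\<^sup>*\<close> is \<open>a L\<^sub>u\<close>, and these elements span the reduced crossed product by \<open>P\<^sup>*\<close> densely.\<close>

definition units_crossed_product ::
  "('g, 'm) monoid_scheme \<Rightarrow> 'g set \<Rightarrow> ('g ell2 \<Rightarrow>\<^sub>L 'g ell2) set"
  where "units_crossed_product G P =
    cstar_algebra hull (diagonal_algebra G P \<union> left_regular G P ` unit_group G P)"

subsection \<open>The operators act as intended\<close>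

lemma square_summable_reindex:
  assumes f: "square_summable f" and "inj_on h X"
  shows "square_summable (\<lambda>x. if x \<in> X then f (h x) else 0)"
    and "norm2 (\<lambda>x. if x \<in> X then f (h x) else 0) \<le> norm2 f"
proof -
  let ?g = "\<lambda>x. if x \<in> X then f (h x) else 0"
  have "L2_set (\<lambda>x. cmod (?g x)) F \<le> norm2 f" if F: "finite F" for F
  proof -
    have inj: "inj_on h (F \<inter> X)" using assms(2) by (auto intro: inj_on_subset)
    have "(\<Sum>x\<in>F. (cmod (?g x))\<^sup>2) = (\<Sum>x\<in>F \<inter> X. (cmod (f (h x)))\<^sup>2)"
      using F by (intro sum.mono_neutral_cong_right) auto
    also have "\<dots> = (\<Sum>y\<in>h ` (F \<inter> X). (cmod (f y))\<^sup>2)"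
      by (simp add: sum.reindex[OF inj])
    finally have "L2_set (\<lambda>x. cmod (?g x)) F = L2_set (\<lambda>x. cmod (f x)) (h ` (F \<inter> X))"
      by (simp add: L2_set_def)
    also have "\<dots> \<le> norm2 f" using f F by (intro L2_set_le_norm2) auto
    finally show ?thesis .
  qed
  from square_summableI[OF this] show "square_summable ?g" "norm2 ?g \<le> norm2 f" by auto
qed

lemma coord_reindex:
  assumes "inj_on h X"
  shows "coord (Blinfun (\<lambda>\<xi>. Abs_ell2 (\<lambda>x. if x \<in> X then coord \<xi> (h x) else 0)) \<xi>) =
    (\<lambda>x. if x \<in> X then coord \<xi> (h x) else 0)"
proof -
  let ?T = "\<lambda>\<xi>. Abs_ell2 (\<lambda>x. if x \<in> X then coord \<xi> (h x) else 0)"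
  have c: "coord (?T \<xi>) = (\<lambda>x. if x \<in> X then coord \<xi> (h x) else 0)" for \<xi>
    using square_summable_reindex(1)[OF square_summable_coord assms]
    by (simp add: Abs_ell2_inverse)
  have "bounded_linear ?T"
  proof (rule bounded_linear_intro)
    show "?T (\<xi> + \<eta>) = ?T \<xi> + ?T \<eta>" for \<xi> \<eta>
      by (rule coord_inject[THEN iffD1]) (auto simp: c plus_ell2.rep_eq)
    show "?T (r *\<^sub>R \<xi>) = r *\<^sub>R ?T \<xi>" for r \<xi>
      by (rule coord_inject[THEN iffD1]) (auto simp: c scaleR_ell2.rep_eq)
    show "norm (?T \<xi>) \<le> norm \<xi> * 1" for \<xi>
      using square_summable_reindex(2)[OF square_summable_coord assms]
      by (simp add: norm_ell2.rep_eq c)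
  qed
  then show ?thesis by (simp add: bounded_linear_Blinfun_apply c)
qed

lemma coord_mult_indicator: "coord (mult_indicator X \<xi>) x = indicator X x * coord \<xi> x"
proof -
  have "(\<lambda>x. indicator X x * coord \<xi> x) = (\<lambda>x. if x \<in> X then coord \<xi> (id x) else 0)" for \<xi>
    by (auto simp: indicator_def)
  then show ?thesis
    unfolding mult_indicator_def using coord_reindex[of id X \<xi>] by (simp add: indicator_def)
qed

lemma coord_left_regular:
  assumes "group G" "submonoid P G" "p \<in> P"
  shows "coord (left_regular G P p \<xi>) = isometry_fun G P p (coord \<xi>)"
proof -
  interpret group G by fact
  interpret submonoid P G by fact
  have "inj_on (\<lambda>x. inv\<^bsub>G\<^esub> p \<otimes>\<^bsub>G\<^esub> x) (p <#\<^bsub>G\<^esub> P)"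
    using assms(3) by (auto intro!: inj_onI simp: l_coset_def inv_solve_left')
  from coord_reindex[OF this, of \<xi>] show ?thesis
    unfolding left_regular_def isometry_fun_def .
qed

lemma left_regular_ket:
  assumes "group G" "submonoid P G" "p \<in> P" "q \<in> P"
  shows "left_regular G P p (ket q) = ket (p \<otimes>\<^bsub>G\<^esub> q)"
proof -
  interpret group G by fact
  interpret submonoid P G by fact
  show ?thesis
    using assms(3,4)
    by (intro coord_inject[THEN iffD1])
      (auto simp: coord_left_regular[OF assms(1-3)] isometry_fun_def ket.rep_eq l_coset_def
        m_assoc[symmetric] intro!: ext)
qed

lemma left_regular_ket_outside:
  assumes "group G" "submonoid P G" "p \<in> P" "x \<notin> P"
  shows "left_regular G P p (ket x) = 0"
proof -
  interpret group G by fact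
  interpret submonoid P G by fact
  show ?thesis
    using assms(3,4)
    by (intro coord_inject[THEN iffD1])
      (auto simp: coord_left_regular[OF assms(1-3)] isometry_fun_def ket.rep_eq l_coset_def
        zero_ell2.rep_eq m_assoc[symmetric] intro!: ext)
qed

lemma left_regular_bounded_operator:
  assumes "group G" "submonoid P G" "p \<in> P"
  shows "left_regular G P p \<in> bounded_operators"
  unfolding bounded_operators_def
  by (auto simp: coord_left_regular[OF assms] isometry_fun_def scaleC_ell2.rep_eq
      intro!: coord_inject[THEN iffD1] ext)

lemma mult_indicator_bounded_operator: "mult_indicator X \<in> bounded_operators"
  unfolding bounded_operators_def
  by (auto simp: coord_mult_indicator scaleC_ell2.rep_eq
      intro!: coord_inject[THEN iffD1] ext)

lemma cinner_eqI:
  fixes x y :: "'h::complex_hilbert_space"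
  assumes "\<And>z. cinner z x = cinner z y"
  shows "x = y"
proof -
  have "cinner (x - y) (x - y) + cinner y (x - y) = cinner x (x - y)"
    by (simp flip: cinner_add_left)
  moreover have "cinner y (x - y) = cinner x (x - y)"
    using assms[of "x - y"] cinner_commute[of y "x - y"] cinner_commute[of x "x - y"] by simp
  ultimately have "cinner (x - y) (x - y) = 0" by simp
  then show ?thesis by (simp add: cinner_self)
qed

text \<open>The hulls above are hulls of sets of complex-linear operators, so the families
  intersected are nonempty and the hulls are again \<open>C\<^sup>*\<close>-algebras.\<close>

lemma cstar_algebra_bounded_operators:
  "cstar_algebra (bounded_operators :: ('h::complex_hilbert_space \<Rightarrow>\<^sub>L 'h) set)"
proof -
  let ?B = "bounded_operators :: ('h \<Rightarrow>\<^sub>L 'h) set"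
  have "op_subspace ?B"
    unfolding op_subspace_def bounded_operators_def
    using scaleC_add_right[of _ 0 "0 :: 'h"]
    by (auto simp: blinfun.add_left scaleC_add_right scaleC_scaleC mult.commute)
  moreover have "closed ?B"
  proof -
    have "?B = (\<Inter>c. \<Inter>x. {T :: 'h \<Rightarrow>\<^sub>L 'h. T (scaleC c x) = Blinfun (scaleC c) (T x)})"
      by (auto simp: bounded_operators_def bounded_linear_Blinfun_apply bounded_linear_scaleC)
    moreover have "closed {T :: 'h \<Rightarrow>\<^sub>L 'h. T (scaleC c x) = Blinfun (scaleC c) (T x)}" for c x
      by (intro closed_Collect_eq continuous_intros)
    ultimately show ?thesis by (metis (no_types, lifting) closed_INT)
  qed
  moreover have "S o\<^sub>L T \<in> ?B" if "S \<in> ?B" "T \<in> ?B" for S T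
    using that by (simp add: bounded_operators_def)
  moreover have "S \<in> ?B" if adj: "is_adjoint S T" and T: "T \<in> ?B" for S T
  proof -
    have "S (scaleC c x) = scaleC c (S x)" for c x
    proof (rule cinner_eqI)
      fix z
      have right: "cinner u (scaleC c v) = cnj c * cinner u v" for u v :: 'h
        using cinner_commute[of u "scaleC c v"] cinner_scaleC_left[of c v u]
          cinner_commute[of u v] by simp
      show "cinner z (S (scaleC c x)) = cinner z (scaleC c (S x))"
        using adj by (metis is_adjoint_def right)
    qed
    then show ?thesis by (simp add: bounded_operators_def)
  qed
  ultimately show ?thesis unfolding cstar_algebra_def by blast
qed

lemma cstar_algebra_Inter:
  assumes "\<A> \<noteq> {}" "\<And>A. A \<in> \<A> \<Longrightarrow> cstar_algebra A"
  shows "cstar_algebra (\<Inter>\<A>)"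
  using assms unfolding cstar_algebra_def op_subspace_def
  by (intro conjI closed_Inter) (blast | meson InterI InterD)+

lemma cstar_algebra_hull:
  assumes "X \<subseteq> bounded_operators"
  shows "cstar_algebra (cstar_algebra hull X)"
  unfolding hull_def
  by (rule cstar_algebra_Inter) (use assms cstar_algebra_bounded_operators in auto)

lemma cstar_algebra_toeplitz:
  assumes "group G" "submonoid P G"
  shows "cstar_algebra (toeplitz_algebra G P)"
  unfolding toeplitz_algebra_def
  using left_regular_bounded_operator[OF assms] by (intro cstar_algebra_hull) blast

lemma diagonal_algebra_bounded_operators:
  fixes G :: "('g, 'm) monoid_scheme"
  shows "diagonal_algebra G P \<subseteq> bounded_operators"
  unfolding diagonal_algebra_def
proof (rule closure_minimal)
  have B: "cstar_algebra (bounded_operators :: ('g ell2 \<Rightarrow>\<^sub>L 'g ell2) set)"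
    by (rule cstar_algebra_bounded_operators)
  then show "closed (bounded_operators :: ('g ell2 \<Rightarrow>\<^sub>L 'g ell2) set)"
    by (simp add: cstar_algebra_def)
  show "op_subspace hull {mult_indicator (constructible G P \<alpha>) |\<alpha>.
      \<alpha> \<in> words P \<and> word_val G \<alpha> = \<one>\<^bsub>G\<^esub>} \<subseteq> bounded_operators"
    using B
    by (intro hull_minimal) (auto simp: cstar_algebra_def mult_indicator_bounded_operator)
qed

lemma cstar_algebra_units_crossed_product:
  assumes "group G" "submonoid P G"
  shows "cstar_algebra (units_crossed_product G P)"
  unfolding units_crossed_product_def
  using left_regular_bounded_operator[OF assms] diagonal_algebra_bounded_operators[of G P]
  by (intro cstar_algebra_hull) (auto simp: unit_group_def)

end

theory Submission
  imports Defs
begin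

text \<open>The operator of a word \<open>\<alpha>\<close> shifts \<open>ket x\<close> to \<open>ket (\<alpha>x)\<close> for \<open>x\<close> in the right ideal \<open>K(\<alpha>)\<close>, and these
  operators span the Toeplitz algebra densely.  Let \<open>a \<ge> 0\<close> be in the ideal with \<open>c = \<langle>a e, e\<rangle> > 0\<close>
  (compress by some \<open>L\<^sub>p\<close> to achieve this), and let \<open>b\<close> be a combination of word operators close to \<open>a\<close>.
  The right ideals \<open>K(\<alpha>) \<noteq> P\<close> do not contain \<open>e\<close>, so there is a diagonal projection \<open>Q\<close> fixing \<open>ket e\<close>
  that kills the word operators in \<open>b\<close>, except those of the form \<open>L\<^sub>u\<close> with \<open>u\<close> a unit.  Then \<open>QbQ\<close> is
  in the crossed product by the units and is close to the element \<open>QaQ\<close> of the ideal, whose norm is at least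
  \<open>c\<close>.  A subalgebra that meets the ideal trivially embeds isometrically in the quotient, which
  excludes this; the quotient is avoided by functional calculus with square roots, which also shows that
  representations are contractive and hence have closed kernels.\<close>


section \<open>Adjoints\<close>

lemma cinner_add_right: "cinner x (y + z) = cinner x y + cinner x z"
  for x :: "'h::complex_hilbert_space"
  using cinner_add_left[of y z x] cinner_commute[of x "y + z"] cinner_commute[of x y]
    cinner_commute[of x z] by simp

lemma cinner_scaleC_right: "cinner x (scaleC c y) = cnj c * cinner x y"
  for x :: "'h::complex_hilbert_space"
  using cinner_commute[of x "scaleC c y"] cinner_scaleC_left[of c y x] cinner_commute[of x y]
  by simp

lemma cinner_scaleR_left: "cinner (r *\<^sub>R x) y = r * cinner x y"
  and cinner_scaleR_right: "cinner x (r *\<^sub>R y) = r * cinner x y"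
  for x :: "'h::complex_hilbert_space"
  by (simp_all add: scaleR_scaleC cinner_scaleC_left cinner_scaleC_right)

lemma cinner_minus_left: "cinner (- x) y = - cinner x y"
  and cinner_minus_right: "cinner x (- y) = - cinner x y"
  for x :: "'h::complex_hilbert_space"
  using cinner_scaleR_left[of "-1" x y] cinner_scaleR_right[of x "-1" y] by simp_all

lemma cinner_diff_left: "cinner (x - y) z = cinner x z - cinner y z"
  and cinner_diff_right: "cinner x (y - z) = cinner x y - cinner x z"
  for x :: "'h::complex_hilbert_space"
  using cinner_add_left[of x "- y" z] cinner_add_right[of x y "- z"]
  by (simp_all add: cinner_minus_left cinner_minus_right)

lemma cinner_zero_left [simp]: "cinner 0 x = 0"
  and cinner_zero_right [simp]: "cinner x 0 = 0"
  for x :: "'h::complex_hilbert_space"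
  using cinner_scaleR_left[of 0 0 x] cinner_scaleR_right[of x 0 0] by simp_all

lemmas cinner_simps = cinner_add_left cinner_add_right cinner_diff_left cinner_diff_right
  cinner_minus_left cinner_minus_right cinner_scaleR_left cinner_scaleR_right
  cinner_scaleC_left cinner_scaleC_right

lemma norm_power2_cinner: "(norm x)\<^sup>2 = Re (cinner x x)"
  for x :: "'h::complex_hilbert_space"
  by (simp add: cinner_self)

lemma Re_cinner_commute: "Re (cinner x y) = Re (cinner y x)"
  for x :: "'h::complex_hilbert_space"
  using cinner_commute[of x y] by simp

text \<open>The squared norm of \<open>norm y *\<^sub>R x - norm x *\<^sub>R y\<close> is the
  difference of the two sides times \<open>2 * (norm x * norm y)\<close>.\<close>

lemma Re_cinner_le: "Re (cinner x y) \<le> norm x * norm y"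
  for x y :: "'h::complex_hilbert_space"
proof (cases "x = 0 \<or> y = 0")
  case False
  have "0 \<le> (norm (norm y *\<^sub>R x - norm x *\<^sub>R y))\<^sup>2" by simp
  also have "\<dots> = 2 * (norm x * norm y) * (norm x * norm y - Re (cinner x y))"
    unfolding norm_power2_cinner[of "_ - _"] cinner_simps
    using Re_cinner_commute[of x y]
    by (simp add: cinner_self) (simp add: algebra_simps power2_eq_square)
  finally have "0 \<le> 2 * (norm x * norm y) * (norm x * norm y - Re (cinner x y))" .
  moreover have "0 < 2 * (norm x * norm y)" using False by simp
  ultimately have "0 \<le> norm x * norm y - Re (cinner x y)"
    by (meson zero_le_mult_iff not_less)
  then show ?thesis by simp
qed auto

text \<open>Multiplying \<open>x\<close> by a scalar of modulus one makes the inner product real and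
  nonnegative, which reduces the claim to \<open>Re_cinner_le\<close>.\<close>

lemma cmod_cinner_le: "cmod (cinner x y) \<le> norm x * norm y"
  for x y :: "'h::complex_hilbert_space"
proof (cases "cinner x y = 0")
  case False
  define c where "c = cnj (cinner x y) / cmod (cinner x y)"
  have c: "cmod c = 1" using False by (simp add: c_def norm_divide)
  have "c * cinner x y = cmod (cinner x y)"
    using False complex_norm_square[of "cinner x y"]
    by (simp add: c_def power2_eq_square field_simps)
  then have "cmod (cinner x y) = Re (cinner (scaleC c x) y)"
    by (simp add: cinner_simps)
  also have "\<dots> \<le> norm x * norm y"
    using Re_cinner_le[of "scaleC c x" y] c by (simp add: norm_scaleC)
  finally show ?thesis .
qed simp

lemma bounded_bilinear_cinner: "bounded_bilinear (cinner :: 'h::complex_hilbert_space \<Rightarrow> 'h \<Rightarrow> complex)"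
  by unfold_locales
    (auto simp: cinner_simps scaleR_conv_of_real intro!: exI[of _ 1] cmod_cinner_le)

section \<open>Calculus of adjoint pairs\<close>

lemma is_adjoint_sym: "is_adjoint S T \<Longrightarrow> is_adjoint T S"
  unfolding is_adjoint_def by (metis cinner_commute)

lemma is_adjoint_unique: "is_adjoint S T \<Longrightarrow> is_adjoint S' T \<Longrightarrow> S = S'"
  unfolding is_adjoint_def by (intro blinfun_eqI cinner_eqI) metis

lemma is_adjoint_zero: "is_adjoint 0 0"
  by (simp add: is_adjoint_def)

lemma is_adjoint_add: "is_adjoint S T \<Longrightarrow> is_adjoint S' T' \<Longrightarrow> is_adjoint (S + S') (T + T')"
  by (simp add: is_adjoint_def blinfun.add_left cinner_simps)

lemma is_adjoint_diff: "is_adjoint S T \<Longrightarrow> is_adjoint S' T' \<Longrightarrow> is_adjoint (S - S') (T - T')"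
  by (simp add: is_adjoint_def blinfun.diff_left cinner_simps)

lemma is_adjoint_scaleR: "is_adjoint S T \<Longrightarrow> is_adjoint (r *\<^sub>R S) (r *\<^sub>R T)"
  by (simp add: is_adjoint_def blinfun.scaleR_left cinner_simps)

lemma is_adjoint_scaleC_op: "is_adjoint S T \<Longrightarrow> is_adjoint (scaleC_op (cnj c) S) (scaleC_op c T)"
  by (simp add: is_adjoint_def cinner_simps)

lemma is_adjoint_compose:
  "is_adjoint S T \<Longrightarrow> is_adjoint S' T' \<Longrightarrow> is_adjoint (S' o\<^sub>L S) (T o\<^sub>L T')"
  by (simp add: is_adjoint_def)

lemmas is_adjoint_intros = is_adjoint_zero is_adjoint_add is_adjoint_diff is_adjoint_scaleR
  is_adjoint_compose

text \<open>The square of \<open>norm (S y)\<close> is the real part of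
  \<open>cinner (T (S y)) y\<close>, so Cauchy-Schwarz bounds \<open>norm S\<close> by
  \<open>norm T\<close>; adjointness is symmetric, which gives the other inequality.\<close>

lemma is_adjoint_norm:
  assumes "is_adjoint S T"
  shows "norm S = norm T"
proof -
  have le: "norm S \<le> norm T" if adj: "is_adjoint S T" for S T :: "'a \<Rightarrow>\<^sub>L 'a"
  proof (rule norm_blinfun_bound)
    fix y
    have "norm (S y) * norm (S y) = Re (cinner (T (S y)) y)"
      using adj norm_power2_cinner[of "S y"] by (simp add: is_adjoint_def power2_eq_square)
    also have "\<dots> \<le> norm (T (S y)) * norm y" by (rule Re_cinner_le)
    also have "\<dots> \<le> norm T * norm (S y) * norm y"
      by (intro mult_right_mono norm_blinfun) auto
    finally have "norm (S y) * norm (S y) \<le> norm (S y) * (norm T * norm y)"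
      by (simp add: mult_ac)
    then show "norm (S y) \<le> norm T * norm y"
      by (cases "S y = 0") auto
  qed simp
  from le[OF assms] le[OF is_adjoint_sym[OF assms]] show ?thesis by simp
qed

lemma is_adjoint_tendsto:
  assumes "\<And>n. is_adjoint (S n) (T n)" "S \<longlonglongrightarrow> S'" "T \<longlonglongrightarrow> T'"
  shows "is_adjoint S' T'"
  unfolding is_adjoint_def
proof (intro allI)
  fix x y
  have "(\<lambda>n. cinner (T n x) y) \<longlonglongrightarrow> cinner (T' x) y"
    by (intro bounded_bilinear.tendsto[OF bounded_bilinear_cinner] tendsto_intros assms)
  moreover have "(\<lambda>n. cinner x (S n y)) \<longlonglongrightarrow> cinner x (S' y)"
    by (intro bounded_bilinear.tendsto[OF bounded_bilinear_cinner] tendsto_intros assms)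
  moreover have "cinner (T n x) y = cinner x (S n y)" for n
    using assms(1) by (simp add: is_adjoint_def)
  ultimately show "cinner (T' x) y = cinner x (S' y)"
    using LIMSEQ_unique by auto
qed

section \<open>Operator subspaces, algebras and their norm closures\<close>

lemma scaleR_eq_scaleC_op: "r *\<^sub>R T = scaleC_op (complex_of_real r) T"
  by (rule blinfun_eqI) (simp add: blinfun.scaleR_left scaleR_scaleC)

lemma op_subspaceD:
  assumes "op_subspace V"
  shows "V \<subseteq> bounded_operators" "0 \<in> V" "S \<in> V \<Longrightarrow> T \<in> V \<Longrightarrow> S + T \<in> V"
    "S \<in> V \<Longrightarrow> T \<in> V \<Longrightarrow> S - T \<in> V" "T \<in> V \<Longrightarrow> scaleC_op c T \<in> V" "T \<in> V \<Longrightarrow> r *\<^sub>R T \<in> V"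
proof -
  note V = assms[unfolded op_subspace_def]
  show "V \<subseteq> bounded_operators" "0 \<in> V" "S \<in> V \<Longrightarrow> T \<in> V \<Longrightarrow> S + T \<in> V"
    "T \<in> V \<Longrightarrow> scaleC_op c T \<in> V" using V by auto
  show sc: "T \<in> V \<Longrightarrow> r *\<^sub>R T \<in> V" for r T
    using V by (auto simp: scaleR_eq_scaleC_op)
  assume "S \<in> V" "T \<in> V"
  then have "S + (-1) *\<^sub>R T \<in> V" using V sc by blast
  then show "S - T \<in> V" by simp
qed

lemma cstar_algebraD:
  assumes "cstar_algebra A"
  shows "op_subspace A" "closed A" "S \<in> A \<Longrightarrow> T \<in> A \<Longrightarrow> S o\<^sub>L T \<in> A"
    "T \<in> A \<Longrightarrow> is_adjoint S T \<Longrightarrow> S \<in> A"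
  using assms unfolding cstar_algebra_def by blast+

lemmas compose_simps =
  bounded_bilinear.add_left[OF bounded_bilinear_blinfun_compose]
  bounded_bilinear.add_right[OF bounded_bilinear_blinfun_compose]
  bounded_bilinear.diff_left[OF bounded_bilinear_blinfun_compose]
  bounded_bilinear.diff_right[OF bounded_bilinear_blinfun_compose]
  bounded_bilinear.scaleR_left[OF bounded_bilinear_blinfun_compose]
  bounded_bilinear.scaleR_right[OF bounded_bilinear_blinfun_compose]

lemma continuous_compose_left: "continuous_on UNIV (\<lambda>T. S o\<^sub>L T)"
  and continuous_compose_right: "continuous_on UNIV (\<lambda>T. T o\<^sub>L S)"
  by (intro bounded_bilinear.continuous_on[OF bounded_bilinear_blinfun_compose]
      continuous_on_const continuous_on_id)+

lemma tendsto_compose: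
  "S \<longlonglongrightarrow> S' \<Longrightarrow> T \<longlonglongrightarrow> T' \<Longrightarrow> (\<lambda>n. S n o\<^sub>L T n) \<longlonglongrightarrow> (S' o\<^sub>L T')"
  by (rule bounded_bilinear.tendsto[OF bounded_bilinear_blinfun_compose])

lemma tendsto_scaleC_op: "T \<longlonglongrightarrow> T' \<Longrightarrow> (\<lambda>n. scaleC_op c (T n)) \<longlonglongrightarrow> scaleC_op c T'"
  unfolding scaleC_op_def by (intro tendsto_compose tendsto_const)

text \<open>Taking adjoints is isometric, so adjoints of a convergent sequence converge.\<close>

lemma closure_cstar_algebra:
  assumes X: "op_subspace X" and prod: "\<And>S T. S \<in> X \<Longrightarrow> T \<in> X \<Longrightarrow> S o\<^sub>L T \<in> X"
    and adj: "\<And>T. T \<in> X \<Longrightarrow> \<exists>S\<in>X. is_adjoint S T"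
  shows "cstar_algebra (closure X)"
    and "T \<in> closure X \<Longrightarrow> \<exists>S\<in>closure X. is_adjoint S T"
proof -
  have lim: "L \<in> closure X" if "l \<longlonglongrightarrow> L" "\<And>n. l n \<in> X" for l L
    using that unfolding closure_sequential by blast
  \<comment> \<open>\<open>cstar_algebra\<close> only asks that adjoints which exist lie in the
    algebra. Existence in the closure is obtained by approximation; uniqueness of adjoints then
    turns it into the closure condition.\<close>
  show ex: "\<exists>S\<in>closure X. is_adjoint S T" if "T \<in> closure X" for T
  proof -
    obtain t where t: "\<And>n. t n \<in> X" "t \<longlonglongrightarrow> T"
      using \<open>T \<in> closure X\<close> unfolding closure_sequential by blast
    have "\<exists>S\<in>X. is_adjoint S (t n)" for n using adj t by blast
    then obtain s where s: "\<And>n. s n \<in> X" "\<And>n. is_adjoint (s n) (t n)" by metis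
    have "Cauchy t" using t(2) by (rule LIMSEQ_imp_Cauchy)
    moreover have "norm (s m - s n) = norm (t m - t n)" for m n
      by (intro is_adjoint_norm is_adjoint_diff s)
    ultimately have "Cauchy s" by (simp add: Cauchy_iff)
    then obtain S where S: "s \<longlonglongrightarrow> S"
      using Cauchy_convergent convergent_def by blast
    then have "S \<in> closure X" using s(1) by (rule lim)
    then show ?thesis using is_adjoint_tendsto[OF s(2) S t(2)] by blast
  qed
  have B: "closure X \<subseteq> bounded_operators"
    using cstar_algebra_bounded_operators op_subspaceD(1)[OF X]
    by (intro closure_minimal) (auto simp: cstar_algebra_def)
  have "0 \<in> closure X"
    using op_subspaceD(2)[OF X] closure_subset by blast
  moreover have "S + T \<in> closure X" "S o\<^sub>L T \<in> closure X"
    if S: "S \<in> closure X" and T: "T \<in> closure X" for S T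
  proof -
    obtain s t where "\<And>n. s n \<in> X" "s \<longlonglongrightarrow> S" "\<And>n. t n \<in> X" "t \<longlonglongrightarrow> T"
      using S T unfolding closure_sequential by blast
    then have "(\<lambda>n. s n + t n) \<longlonglongrightarrow> S + T" "\<And>n. s n + t n \<in> X"
      "(\<lambda>n. s n o\<^sub>L t n) \<longlonglongrightarrow> (S o\<^sub>L T)" "\<And>n. s n o\<^sub>L t n \<in> X"
      by (auto intro: tendsto_add tendsto_compose op_subspaceD(3)[OF X] prod)
    then show "S + T \<in> closure X" "S o\<^sub>L T \<in> closure X"
      by (blast intro: lim)+
  qed
  moreover have "scaleC_op c T \<in> closure X" if "T \<in> closure X" for c T
  proof -
    obtain t where "\<And>n. t n \<in> X" "t \<longlonglongrightarrow> T"
      using \<open>T \<in> closure X\<close> unfolding closure_sequential by blast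
    then have "(\<lambda>n. scaleC_op c (t n)) \<longlonglongrightarrow> scaleC_op c T" "\<And>n. scaleC_op c (t n) \<in> X"
      by (auto intro: tendsto_scaleC_op op_subspaceD(5)[OF X])
    then show ?thesis by (rule lim)
  qed
  moreover have "S \<in> closure X" if "T \<in> closure X" "is_adjoint S T" for S T
    using ex[OF that(1)] is_adjoint_unique[OF that(2)] by auto
  ultimately show "cstar_algebra (closure X)"
    using B unfolding cstar_algebra_def op_subspace_def by blast
qed


section \<open>Square roots and positive parts\<close>

lemma blinfun_compose_assoc: "R o\<^sub>L S o\<^sub>L T = R o\<^sub>L (S o\<^sub>L T)"
  by (rule blinfun_eqI) simp

text \<open>Each iterate is a polynomial in \<open>x\<close> without constant term. So it stays in
  every algebra containing \<open>x\<close>, and modulo an ideal it depends only on the class of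
  \<open>x\<close>.\<close>

primrec sqrt_iter :: "('h::complex_hilbert_space \<Rightarrow>\<^sub>L 'h) \<Rightarrow> nat \<Rightarrow> 'h \<Rightarrow>\<^sub>L 'h" where
  "sqrt_iter x 0 = 0"
| "sqrt_iter x (Suc n) = (1 / 2) *\<^sub>R (x + (sqrt_iter x n o\<^sub>L sqrt_iter x n))"

text \<open>For \<open>\<parallel>x\<parallel> \<le> 1\<close> the limit \<open>s\<close> of the iteration satisfies \<open>2s = x + s\<^sup>2\<close>, that is
  \<open>(1 - s)\<^sup>2 = 1 - x\<close>.\<close>

definition sqrt_defect :: "('h::complex_hilbert_space \<Rightarrow>\<^sub>L 'h) \<Rightarrow> 'h \<Rightarrow>\<^sub>L 'h" where
  "sqrt_defect x = lim (sqrt_iter x)"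

text \<open>The same iteration for the number 1. It dominates the norms of the iterates and of their
  increments when \<open>norm x \<le> 1\<close>.\<close>

primrec sqrt_majorant :: "nat \<Rightarrow> real" where
  "sqrt_majorant 0 = 0"
| "sqrt_majorant (Suc n) = (1 + (sqrt_majorant n)\<^sup>2) / 2"

lemma sqrt_majorant_bounds: "0 \<le> sqrt_majorant n \<and> sqrt_majorant n \<le> 1"
  by (induction n) (auto simp: power_le_one)

lemma sqrt_majorant_Suc_ge: "sqrt_majorant n \<le> sqrt_majorant (Suc n)"
proof -
  have "0 \<le> (1 - sqrt_majorant n)\<^sup>2" by simp
  then show ?thesis by (simp add: power2_eq_square algebra_simps)
qed

lemma sqrt_iter_norm: "norm x \<le> 1 \<Longrightarrow> norm (sqrt_iter x n) \<le> sqrt_majorant n"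
proof (induction n)
  case (Suc n)
  have "norm (sqrt_iter x n o\<^sub>L sqrt_iter x n) \<le> norm (sqrt_iter x n) * norm (sqrt_iter x n)"
    by (rule norm_blinfun_compose)
  also have "\<dots> \<le> (sqrt_majorant n)\<^sup>2"
    unfolding power2_eq_square using Suc by (intro mult_mono) (auto simp: sqrt_majorant_bounds)
  finally show ?case
    using norm_triangle_ineq[of x "(sqrt_iter x n o\<^sub>L sqrt_iter x n)"] Suc.prems by simp
qed simp

lemma sqrt_iter_norm_diff:
  assumes "norm x \<le> 1"
  shows "norm (sqrt_iter x (Suc n) - sqrt_iter x n) \<le> sqrt_majorant (Suc n) - sqrt_majorant n"
proof (induction n)
  case 0
  then show ?case using assms by simp
next
  case (Suc n)
  let ?s = "sqrt_iter x" and ?t = sqrt_majorant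
  let ?d = "?s (Suc n) - ?s n" and ?e = "?t (Suc n) - ?t n"
  \<comment> \<open>The difference of the two squares is split in a way that is valid without
    commutativity; the majorant satisfies the same identity.\<close>
  have "?s (Suc (Suc n)) - ?s (Suc n) = (1 / 2) *\<^sub>R ((?d o\<^sub>L ?s (Suc n)) + (?s n o\<^sub>L ?d))"
    unfolding sqrt_iter.simps(2)[of x "Suc n"] sqrt_iter.simps(2)[of x n]
    by (simp add: compose_simps algebra_simps)
  then have "norm (?s (Suc (Suc n)) - ?s (Suc n))
      = (1 / 2) * norm ((?d o\<^sub>L ?s (Suc n)) + (?s n o\<^sub>L ?d))"
    by simp
  also have "norm ((?d o\<^sub>L ?s (Suc n)) + (?s n o\<^sub>L ?d))
      \<le> norm ?d * norm (?s (Suc n)) + norm (?s n) * norm ?d"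
    by (intro norm_triangle_le add_mono norm_blinfun_compose)
  also have "\<dots> \<le> ?e * ?t (Suc n) + ?t n * ?e"
    using sqrt_majorant_Suc_ge[of n]
    by (intro add_mono mult_mono Suc sqrt_iter_norm[OF assms] norm_ge_zero)
      (auto simp: sqrt_majorant_bounds simp del: sqrt_majorant.simps)
  also have "(1 / 2) * (?e * ?t (Suc n) + ?t n * ?e) = ?t (Suc (Suc n)) - ?t (Suc n)"
    unfolding sqrt_majorant.simps(2)[of "Suc n"] sqrt_majorant.simps(2)[of n]
    by (simp add: power2_eq_square field_simps)
  finally show ?case by simp
qed

text \<open>The majorant is increasing and bounded, so its increments are summable; they dominate
  the increments of the iteration, which therefore form a convergent series.\<close>

lemma sqrt_iter_tendsto:
  assumes "norm x \<le> 1"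
  shows "sqrt_iter x \<longlonglongrightarrow> sqrt_defect x"
proof -
  have "convergent sqrt_majorant"
    by (rule Bseq_mono_convergent)
      (auto intro!: BseqI'[where K = 1] incseq_SucI
        simp: sqrt_majorant_bounds sqrt_majorant_Suc_ge incseq_def[symmetric]
        simp del: sqrt_majorant.simps dest: incseqD)
  then obtain L where "sqrt_majorant \<longlonglongrightarrow> L" by (auto simp: convergent_def)
  then have "summable (\<lambda>n. sqrt_majorant (Suc n) - sqrt_majorant n)"
    by (rule telescope_summable)
  then have "summable (\<lambda>n. sqrt_iter x (Suc n) - sqrt_iter x n)"
    by (rule summable_comparison_test[rotated]) (use sqrt_iter_norm_diff[OF assms] in blast)
  then have "convergent (\<lambda>n. sqrt_iter x n - sqrt_iter x 0)"
    by (simp only: summable_iff_convergent sum_lessThan_telescope)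
  then show ?thesis
    by (simp add: sqrt_defect_def convergent_LIMSEQ_iff)
qed

lemma sqrt_defect_eq:
  assumes "norm x \<le> 1"
  shows "2 *\<^sub>R sqrt_defect x = x + (sqrt_defect x o\<^sub>L sqrt_defect x)"
proof -
  note lim = sqrt_iter_tendsto[OF assms]
  have "(\<lambda>n. sqrt_iter x (Suc n)) \<longlonglongrightarrow> (1 / 2) *\<^sub>R (x + (sqrt_defect x o\<^sub>L sqrt_defect x))"
    unfolding sqrt_iter.simps by (intro tendsto_intros tendsto_compose lim)
  then have "(1 / 2) *\<^sub>R (x + (sqrt_defect x o\<^sub>L sqrt_defect x)) = sqrt_defect x"
    using LIMSEQ_Suc[OF lim] by (rule LIMSEQ_unique)
  then have "2 *\<^sub>R (1 / 2) *\<^sub>R (x + (sqrt_defect x o\<^sub>L sqrt_defect x)) = 2 *\<^sub>R sqrt_defect x"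
    by simp
  then show ?thesis by simp
qed

lemma sqrt_defect_norm:
  assumes "norm x \<le> 1"
  shows "norm (sqrt_defect x) \<le> 1"
  by (rule LIMSEQ_le_const2[OF tendsto_norm[OF sqrt_iter_tendsto[OF assms]]])
    (meson order_trans sqrt_iter_norm[OF assms] sqrt_majorant_bounds)

lemma sqrt_defect_adjoint:
  assumes "norm x \<le> 1" "is_adjoint x x"
  shows "is_adjoint (sqrt_defect x) (sqrt_defect x)"
proof -
  have "is_adjoint (sqrt_iter x n) (sqrt_iter x n)" for n
    by (induction n) (auto intro: is_adjoint_intros assms)
  then show ?thesis
    using sqrt_iter_tendsto[OF assms(1)] by (auto intro: is_adjoint_tendsto)
qed

lemma sqrt_defect_commute:
  assumes "norm x \<le> 1" "y o\<^sub>L x = x o\<^sub>L y"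
  shows "y o\<^sub>L sqrt_defect x = sqrt_defect x o\<^sub>L y"
proof -
  have "y o\<^sub>L sqrt_iter x n = sqrt_iter x n o\<^sub>L y" for n
    by (induction n) (simp_all add: compose_simps assms(2), metis blinfun_compose_assoc)
  moreover note lim = sqrt_iter_tendsto[OF assms(1)]
  have "(\<lambda>n. y o\<^sub>L sqrt_iter x n) \<longlonglongrightarrow> (y o\<^sub>L sqrt_defect x)"
    "(\<lambda>n. sqrt_iter x n o\<^sub>L y) \<longlonglongrightarrow> (sqrt_defect x o\<^sub>L y)"
    by (intro tendsto_compose lim tendsto_const)+
  ultimately show ?thesis by (simp add: LIMSEQ_unique)
qed

lemma sqrt_defect_mem:
  assumes "norm x \<le> 1" "cstar_algebra A" "x \<in> A"
  shows "sqrt_defect x \<in> A"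
proof -
  note A = cstar_algebraD[OF assms(2)]
  have "sqrt_iter x n \<in> A" for n
    by (induction n) (simp_all add: op_subspaceD[OF A(1)] A(3) assms(3))
  then show ?thesis
    by (rule closed_sequentially[OF A(2) _ sqrt_iter_tendsto[OF assms(1)]])
qed

text \<open>Congruence modulo \<open>I\<close> respects products. This lemma and the next replace
  computations in the quotient of \<open>A\<close> by \<open>I\<close>.\<close>

lemma compose_diff_mem_ideal:
  assumes "closed_ideal A I" "S \<in> A" "T' \<in> A" "S - S' \<in> I" "T - T' \<in> I"
  shows "(S o\<^sub>L T) - (S' o\<^sub>L T') \<in> I"
proof -
  have "(S o\<^sub>L T) - (S' o\<^sub>L T') = (S o\<^sub>L (T - T')) + ((S - S') o\<^sub>L T')"
    by (simp add: compose_simps)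
  then show ?thesis
    using assms op_subspaceD(3)[of I] by (auto simp: closed_ideal_def)
qed

lemma sqrt_defect_diff_mem_ideal:
  assumes "norm x \<le> 1" "norm y \<le> 1" "cstar_algebra A" "x \<in> A" "y \<in> A"
    and I: "closed_ideal A I" "x - y \<in> I"
  shows "sqrt_defect x - sqrt_defect y \<in> I"
proof -
  note A = cstar_algebraD[OF assms(3)]
  have I': "op_subspace I" "closed I" using I by (auto simp: closed_ideal_def)
  have mem: "sqrt_iter z n \<in> A" if "z \<in> A" for z n
    by (induction n) (simp_all add: op_subspaceD[OF A(1)] A(3) that)
  have "sqrt_iter x n - sqrt_iter y n \<in> I" for n
  proof (induction n)
    case (Suc n)
    have "sqrt_iter x (Suc n) - sqrt_iter y (Suc n) = (1 / 2) *\<^sub>R ((x - y) +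
        ((sqrt_iter x n o\<^sub>L sqrt_iter x n) - (sqrt_iter y n o\<^sub>L sqrt_iter y n)))"
      by (simp add: algebra_simps)
    also have "\<dots> \<in> I"
      using compose_diff_mem_ideal[OF I(1) mem mem Suc Suc] assms I(2)
      by (intro op_subspaceD(3,6)[OF I'(1)]) auto
    finally show ?case .
  qed (simp add: op_subspaceD[OF I'(1)])
  then show ?thesis
    by (rule closed_sequentially[OF I'(2)
          _ tendsto_diff[OF sqrt_iter_tendsto sqrt_iter_tendsto, OF assms(1,2)]])
qed

section \<open>Positive operators and uniqueness of square roots\<close>

definition positive_op :: "('h::complex_hilbert_space \<Rightarrow>\<^sub>L 'h) \<Rightarrow> bool" where
  "positive_op T \<longleftrightarrow> is_adjoint T T \<and> (\<forall>v. 0 \<le> Re (cinner (T v) v))"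

lemma cinner_compose_adjoint: "is_adjoint S T \<Longrightarrow> Re (cinner ((S o\<^sub>L T) v) v) = (norm (T v))\<^sup>2"
  using is_adjoint_sym[of S T] by (simp add: norm_power2_cinner is_adjoint_def)

text \<open>Polarization: if \<open>w\<close> is \<open>T v\<close> rescaled to the length of
  \<open>v\<close>, then \<open>4 * (norm v * norm (T v))\<close> is the difference of the quadratic
  forms at \<open>v + w\<close> and \<open>v - w\<close>, and the parallelogram law bounds
  it.\<close>

lemma norm_le_quadratic_form:
  assumes "is_adjoint T T" "0 \<le> M" and M: "\<And>v. \<bar>Re (cinner (T v) v)\<bar> \<le> M * (norm v)\<^sup>2"
  shows "norm T \<le> M"
proof (rule norm_blinfun_bound)
  fix v
  show "norm (T v) \<le> M * norm v"
  proof (cases "T v = 0")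
    case False
    then have "v \<noteq> 0" by auto
    define w where "w = (norm v / norm (T v)) *\<^sub>R T v"
    have w: "norm w = norm v" using False by (simp add: w_def)
    have "Re (cinner (T v) w) = norm v * norm (T v)"
      using False
      by (simp add: w_def cinner_simps power2_eq_square flip: norm_power2_cinner)
    moreover have "Re (cinner (T w) v) = Re (cinner (T v) w)"
      using assms(1) Re_cinner_commute[of "T v" w] by (simp add: is_adjoint_def)
    ultimately have "4 * (norm v * norm (T v)) =
        Re (cinner (T (v + w)) (v + w)) - Re (cinner (T (v - w)) (v - w))"
      by (simp add: blinfun.add_right blinfun.diff_right cinner_simps)
    also have "\<dots> \<le> M * (norm (v + w))\<^sup>2 + M * (norm (v - w))\<^sup>2"
      using M[of "v + w"] M[of "v - w"] by linarith
    also have "\<dots> = M * ((norm (v + w))\<^sup>2 + (norm (v - w))\<^sup>2)"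
      by (simp add: algebra_simps)
    also have "(norm (v + w))\<^sup>2 + (norm (v - w))\<^sup>2 = 2 * (norm v)\<^sup>2 + 2 * (norm w)\<^sup>2"
      unfolding norm_power2_cinner by (simp add: cinner_simps)
    finally have "norm v * norm (T v) \<le> norm v * (M * norm v)"
      by (simp add: w power2_eq_square algebra_simps)
    then show ?thesis using \<open>v \<noteq> 0\<close> by simp
  qed (simp add: assms(2))
qed (fact assms(2))

text \<open>With \<open>Z = R - S\<close> the hypotheses give
  \<open>(R + S) o\<^sub>L Z = 0\<close>. By positivity the forms of \<open>R\<close> and
  \<open>S\<close> both vanish on the range of \<open>Z\<close>, hence the form of the cube of
  \<open>Z\<close> vanishes. So this cube is 0, and a self-adjoint nilpotent operator is 0.\<close>

lemma positive_op_sqrt_unique: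
  assumes R: "positive_op R" and S: "positive_op S" and sq: "R o\<^sub>L R = S o\<^sub>L S"
    and comm: "R o\<^sub>L S = S o\<^sub>L R"
  shows "R = S"
proof -
  define Z where "Z = R - S"
  have adj: "is_adjoint Z Z"
    unfolding Z_def using R S by (auto simp: positive_op_def intro: is_adjoint_diff)
  have "(R + S) o\<^sub>L Z = 0"
    by (simp add: Z_def compose_simps sq comm)
  then have sum0: "R (Z v) + S (Z v) = 0" for v
    by (metis blinfun.add_left blinfun_apply_blinfun_compose blinfun.zero_left)
  have Z3: "Re (cinner (Z (Z (Z v))) v) = 0" for v
  proof -
    have "Re (cinner (R (Z v)) (Z v)) + Re (cinner (S (Z v)) (Z v)) = 0"
      using sum0[of v] by (simp flip: cinner_add_left plus_complex.sel)
    moreover have "0 \<le> Re (cinner (R (Z v)) (Z v))" "0 \<le> Re (cinner (S (Z v)) (Z v))"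
      using R S by (auto simp: positive_op_def)
    ultimately have "Re (cinner (R (Z v)) (Z v)) = 0" "Re (cinner (S (Z v)) (Z v)) = 0"
      by auto
    then have "Re (cinner (Z (Z v)) (Z v)) = 0"
      by (simp add: Z_def blinfun.diff_left cinner_simps)
    then show ?thesis using adj by (simp add: is_adjoint_def)
  qed
  have "norm (Z o\<^sub>L Z o\<^sub>L Z) \<le> 0"
    by (rule norm_le_quadratic_form)
      (use Z3 is_adjoint_compose[OF is_adjoint_compose[OF adj adj] adj]
        in \<open>auto simp: blinfun_compose_assoc\<close>)
  then have Z3': "Z (Z (Z v)) = 0" for v
    by (metis blinfun_apply_blinfun_compose blinfun.zero_left norm_le_zero_iff)
  have "Z (Z v) = 0" for v
    using norm_power2_cinner[of "Z (Z v)"] adj Z3'[of v] by (simp add: is_adjoint_def)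
  then have "Z v = 0" for v
    using norm_power2_cinner[of "Z v"] adj by (simp add: is_adjoint_def)
  then show ?thesis
    by (intro blinfun_eqI) (simp add: Z_def blinfun.diff_left)
qed

section \<open>Functional calculus in an algebra whose unit is a projection\<close>

lemma projection_norm_le:
  assumes "is_adjoint U U" "U o\<^sub>L U = U"
  shows "norm (U v) \<le> norm v"
proof -
  have "norm (U v) * norm (U v) = Re (cinner (U v) v)"
    using cinner_compose_adjoint[OF assms(1), of v] by (simp add: assms(2) power2_eq_square)
  also have "\<dots> \<le> norm (U v) * norm v" by (rule Re_cinner_le)
  finally show ?thesis by (cases "U v = 0") auto
qed

text \<open>The unit \<open>U\<close> may differ from the identity operator: for the Toeplitz
  algebra it is the projection onto the functions supported on \<open>P\<close>.\<close>

locale unital_cstar_algebra =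
  fixes A :: "('h::complex_hilbert_space \<Rightarrow>\<^sub>L 'h) set" and U
  assumes cstar: "cstar_algebra A" and U: "U \<in> A" "is_adjoint U U"
    and unit: "T \<in> A \<Longrightarrow> U o\<^sub>L T = T" "T \<in> A \<Longrightarrow> T o\<^sub>L U = T"
begin

lemmas subspace = op_subspaceD[OF cstar_algebraD(1)[OF cstar]]
lemmas mult_mem = cstar_algebraD(3)[OF cstar]

lemma norm_U_apply: "norm (U v) \<le> norm v"
  by (rule projection_norm_le) (simp_all add: U unit)

lemma norm_U: "norm U \<le> 1"
  by (rule norm_blinfun_bound) (simp_all add: norm_U_apply)

lemma cinner_U: "Re (cinner (U v) v) = (norm (U v))\<^sup>2"
  using cinner_compose_adjoint[OF U(2), of v] by (simp add: unit U)

lemma apply_U: "T \<in> A \<Longrightarrow> T (U v) = T v"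
  by (metis unit(2) blinfun_apply_blinfun_compose)

text \<open>The square is the equation \<open>sqrt_defect_eq\<close> rearranged. For positivity,
  \<open>sqrt_defect x\<close> is a contraction that is unchanged by compression with
  \<open>U\<close>, so its form is at most that of \<open>U\<close>.\<close>

lemma sqrt_complement:
  assumes x: "x \<in> A" "norm x \<le> 1"
  shows "U - sqrt_defect x \<in> A"
    and "(U - sqrt_defect x) o\<^sub>L (U - sqrt_defect x) = U - x"
    and "is_adjoint x x \<Longrightarrow> positive_op (U - sqrt_defect x)"
proof -
  let ?s = "sqrt_defect x"
  have s: "?s \<in> A" by (rule sqrt_defect_mem[OF x(2) cstar x(1)])
  then show "U - ?s \<in> A" by (intro subspace U)
  have "(U - ?s) o\<^sub>L (U - ?s) = U - 2 *\<^sub>R ?s + (?s o\<^sub>L ?s)"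
    by (simp add: compose_simps unit s U scaleR_2)
  then show "(U - ?s) o\<^sub>L (U - ?s) = U - x"
    using sqrt_defect_eq[OF x(2)] by simp
  assume adj: "is_adjoint x x"
  have "Re (cinner (?s v) v) \<le> Re (cinner (U v) v)" for v
  proof -
    have "?s v = U (?s (U v))"
      by (metis apply_U s unit(1) blinfun_apply_blinfun_compose)
    then have "Re (cinner (?s v) v) = Re (cinner (?s (U v)) (U v))"
      using U(2) by (simp add: is_adjoint_def)
    also have "\<dots> \<le> norm (?s (U v)) * norm (U v)" by (rule Re_cinner_le)
    also have "\<dots> \<le> norm ?s * norm (U v) * norm (U v)"
      by (intro mult_right_mono norm_blinfun norm_ge_zero)
    also have "\<dots> \<le> 1 * norm (U v) * norm (U v)"
      by (intro mult_right_mono sqrt_defect_norm x norm_ge_zero)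
    finally show ?thesis by (simp add: cinner_U power2_eq_square)
  qed
  then show "positive_op (U - ?s)"
    unfolding positive_op_def
    using is_adjoint_diff[OF U(2) sqrt_defect_adjoint[OF x(2) adj]]
    by (simp add: blinfun.diff_left cinner_simps)
qed

text \<open>The quadratic form is \<open>(norm (U v))\<^sup>2 - (norm (T v))\<^sup>2\<close>, which
  lies between 0 and \<open>(norm v)\<^sup>2\<close>. The bound makes \<open>sqrt_defect\<close>
  converge in \<open>positive_part\<close>.\<close>

lemma norm_complement_square:
  assumes "T \<in> A" "is_adjoint T T" "norm T \<le> 1"
  shows "norm (U - (T o\<^sub>L T)) \<le> 1"
proof (rule norm_le_quadratic_form)
  show "is_adjoint (U - (T o\<^sub>L T)) (U - (T o\<^sub>L T))"
    by (intro is_adjoint_intros U assms)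
  fix v
  have "norm (T v) \<le> norm T * norm (U v)"
    using norm_blinfun[of T "U v"] by (simp add: apply_U assms)
  also have "\<dots> \<le> norm (U v)"
    using assms(3) by (simp add: mult_left_le_one_le)
  finally have "(norm (T v))\<^sup>2 \<le> (norm (U v))\<^sup>2" by (simp add: power_mono)
  moreover have "(norm (U v))\<^sup>2 \<le> (norm v)\<^sup>2" by (simp add: power_mono norm_U_apply)
  moreover have "Re (cinner ((U - (T o\<^sub>L T)) v) v) = (norm (U v))\<^sup>2 - (norm (T v))\<^sup>2"
    using cinner_compose_adjoint[OF assms(2), of v]
    by (simp add: blinfun.diff_left cinner_simps cinner_U)
  ultimately show "\<bar>Re (cinner ((U - (T o\<^sub>L T)) v) v)\<bar> \<le> 1 * (norm v)\<^sup>2"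
    by (smt (verit) zero_le_power2)
qed simp

text \<open>Twice the positive part of \<open>T\<close>, since \<open>U - sqrt_defect (U - T\<^sup>2) = \<bar>T\<bar>\<close>.\<close>

definition positive_part :: "('h \<Rightarrow>\<^sub>L 'h) \<Rightarrow> 'h \<Rightarrow>\<^sub>L 'h" where
  "positive_part T = T + (U - sqrt_defect (U - (T o\<^sub>L T)))"

text \<open>The root \<open>R\<close> of the square of \<open>T\<close> is positive and commutes
  with \<open>T\<close>. By uniqueness of such roots, \<open>- T\<close> is positive exactly when it
  equals \<open>R\<close>.\<close>

lemma positive_part:
  assumes T: "T \<in> A" "is_adjoint T T" "norm T \<le> 1"
  shows "positive_part T = 0 \<longleftrightarrow> positive_op (- T)"
proof -
  define x where "x = U - (T o\<^sub>L T)"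
  define R where "R = U - sqrt_defect x"
  have x: "x \<in> A" "norm x \<le> 1" "is_adjoint x x"
    using norm_complement_square[OF T] is_adjoint_diff[OF U(2) is_adjoint_compose[OF T(2) T(2)]]
    by (auto simp: x_def intro: subspace mult_mem U T)
  note R = sqrt_complement[OF x(1,2), folded R_def]
  have "positive_op (- T) \<longleftrightarrow> R = - T"
  proof
    assume "positive_op (- T)"
    moreover have "R o\<^sub>L R = - T o\<^sub>L - T"
      using R(2)
      by (simp add: x_def bounded_bilinear.minus_left[OF bounded_bilinear_blinfun_compose]
          bounded_bilinear.minus_right[OF bounded_bilinear_blinfun_compose])
    moreover have "R o\<^sub>L - T = - T o\<^sub>L R"
    proof -
      have "T o\<^sub>L x = x o\<^sub>L T"
        by (simp add: x_def compose_simps unit T blinfun_compose_assoc)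
      then have "T o\<^sub>L sqrt_defect x = sqrt_defect x o\<^sub>L T"
        by (rule sqrt_defect_commute[OF x(2)])
      then show ?thesis
        by (simp add: R_def compose_simps unit T
            bounded_bilinear.minus_left[OF bounded_bilinear_blinfun_compose]
            bounded_bilinear.minus_right[OF bounded_bilinear_blinfun_compose])
    qed
    ultimately show "R = - T"
      by (rule positive_op_sqrt_unique[OF R(3)[OF x(3)]])
  next
    assume "R = - T"
    then show "positive_op (- T)" using R(3)[OF x(3)] by simp
  qed
  also have "\<dots> \<longleftrightarrow> positive_part T = 0"
    unfolding positive_part_def R_def[symmetric] x_def[symmetric]
    by (auto simp: eq_neg_iff_add_eq_0 add.commute)
  finally show ?thesis by blast
qed

lemma positive_part_mem:
  assumes "cstar_algebra B" "U \<in> B" "T \<in> B" "B \<subseteq> A" "is_adjoint T T" "norm T \<le> 1"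
  shows "positive_part T \<in> B"
proof -
  note B = op_subspaceD[OF cstar_algebraD(1)[OF assms(1)]] cstar_algebraD(3)[OF assms(1)]
  have "norm (U - (T o\<^sub>L T)) \<le> 1"
    using assms by (intro norm_complement_square) auto
  then show ?thesis
    unfolding positive_part_def using assms by (intro B sqrt_defect_mem[of _ B])
qed

text \<open>The positive part is built from products and \<open>sqrt_defect\<close>, both compatible
  with congruence modulo \<open>I\<close>.\<close>

lemma positive_part_diff_mem_ideal:
  assumes S: "S \<in> A" "is_adjoint S S" "norm S \<le> 1" and T: "T \<in> A" "is_adjoint T T" "norm T \<le> 1"
    and I: "closed_ideal A I" "S - T \<in> I"
  shows "positive_part S - positive_part T \<in> I"
proof -
  have I': "op_subspace I" using I by (simp add: closed_ideal_def)
  let ?x = "U - (S o\<^sub>L S)" and ?y = "U - (T o\<^sub>L T)"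
  have "?y - ?x \<in> I"
    using compose_diff_mem_ideal[OF I(1) S(1) T(1) I(2) I(2)] by simp
  then have "sqrt_defect ?y - sqrt_defect ?x \<in> I"
    using I(1) S T
    by (intro sqrt_defect_diff_mem_ideal[of _ _ A] norm_complement_square cstar)
      (auto intro: subspace mult_mem U)
  with I(2) have "(S - T) + (sqrt_defect ?y - sqrt_defect ?x) \<in> I"
    by (rule op_subspaceD(3)[OF I'])
  then show ?thesis by (simp add: positive_part_def algebra_simps)
qed

text \<open>If \<open>y\<close> is nearer to \<open>I\<close> than to \<open>0\<close>, then for a suitable \<open>\<delta>\<close> the positive part of \<open>y\<^sup>2 - \<delta>\<close> is
  nonzero, but it vanishes modulo \<open>I\<close>.\<close>

lemma ideal_meets_subalgebra_aux:
  assumes B: "cstar_algebra B" "U \<in> B" "B \<subseteq> A" and I: "closed_ideal A I"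
    and x: "x \<in> I" "is_adjoint x x" and y: "y \<in> B" "is_adjoint y y"
    and less: "norm (y - x) < norm y" and small: "norm y \<le> 1 / 2"
  shows "\<exists>z\<in>I \<inter> B. z \<noteq> 0"
proof -
  \<comment> \<open>With this \<open>d\<close>, the form of \<open>a (y - x)\<close> is nowhere
    positive, whereas that of \<open>a y\<close> is positive somewhere because
    \<open>norm (y - x) < norm y\<close>.\<close>
  define d where "d = (norm (y - x))\<^sup>2"
  define a where "a = (\<lambda>T. (T o\<^sub>L T) - d *\<^sub>R U)"
  have I': "op_subspace I" "I \<subseteq> A" using I by (auto simp: closed_ideal_def)
  note Bs = op_subspaceD[OF cstar_algebraD(1)[OF B(1)]] cstar_algebraD(3)[OF B(1)]
  have d: "0 \<le> d" "d \<le> 1 / 4"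
    using less small power_mono[of "norm (y - x)" "1 / 2" 2]
    by (auto simp: d_def power2_eq_square)
  \<comment> \<open>Norms at most 1/2 keep \<open>a T\<close> in the unit ball, where
    \<open>positive_part\<close> is under control.\<close>
  have a: "a T \<in> A" "is_adjoint (a T) (a T)" "norm (a T) \<le> 1"
    if "T \<in> A" "is_adjoint T T" "norm T \<le> 1 / 2" for T
  proof -
    show "a T \<in> A" "is_adjoint (a T) (a T)"
      unfolding a_def using that by (auto intro: subspace mult_mem U is_adjoint_intros)
    have "norm (a T) \<le> norm (T o\<^sub>L T) + norm (d *\<^sub>R U)"
      unfolding a_def by (rule norm_triangle_ineq4)
    also have "norm (T o\<^sub>L T) \<le> norm T * norm T" by (rule norm_blinfun_compose)
    also have "\<dots> \<le> 1 / 2 * (1 / 2)" using that(3) by (intro mult_mono) auto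
    also have "norm (d *\<^sub>R U) \<le> 1 / 4 * 1"
      unfolding norm_scaleR using d norm_U by (intro mult_mono) auto
    finally show "norm (a T) \<le> 1" by simp
  qed
  have neg: "positive_op (- a T) \<longleftrightarrow> (\<forall>v. (norm (T v))\<^sup>2 \<le> d * (norm (U v))\<^sup>2)"
    if "T \<in> A" "is_adjoint T T" for T
  proof -
    have "is_adjoint (- a T) (- a T)"
      using that is_adjoint_diff[OF is_adjoint_scaleR[OF U(2), of d] is_adjoint_compose[of T T T T]]
      by (simp add: a_def)
    moreover have "Re (cinner ((- a T) v) v) = d * (norm (U v))\<^sup>2 - (norm (T v))\<^sup>2" for v
      using cinner_compose_adjoint[OF that(2), of v]
      by (simp add: a_def blinfun.diff_left blinfun.minus_left blinfun.scaleR_left cinner_simps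
          cinner_U)
    ultimately show ?thesis by (simp add: positive_op_def)
  qed
  have yA: "y \<in> A" and yx: "y - x \<in> A" "is_adjoint (y - x) (y - x)" "norm (y - x) \<le> 1 / 2"
    using x y B I' less small by (auto intro: subspace is_adjoint_diff)
  let ?z = "positive_part (a y)"
  have "positive_op (- a (y - x))"
  proof (subst neg[OF yx(1,2)], intro allI)
    fix v
    have "norm ((y - x) v) \<le> norm (y - x) * norm (U v)"
      using norm_blinfun[of "y - x" "U v"] by (simp add: apply_U yx)
    then show "(norm ((y - x) v))\<^sup>2 \<le> d * (norm (U v))\<^sup>2"
      unfolding d_def by (simp add: power_mono flip: power_mult_distrib)
  qed
  then have "positive_part (a (y - x)) = 0"
    using positive_part[OF a[OF yx]] by simp
  \<comment> \<open>\<open>y\<close> and \<open>y - x\<close> differ by an element of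
    \<open>I\<close>, so the vanishing positive part of \<open>a (y - x)\<close> puts that of
    \<open>a y\<close> into \<open>I\<close>.\<close>
  moreover have "a y - a (y - x) \<in> I"
    using compose_diff_mem_ideal[OF I yA yx(1), of "y - x" y] x(1) by (simp add: a_def)
  ultimately have "?z \<in> I"
    using positive_part_diff_mem_ideal[OF a[OF yA y(2) small] a[OF yx] I] by simp
  moreover have "?z \<in> B"
    using a[OF yA y(2) small] y B
    by (intro positive_part_mem) (auto simp: a_def intro: Bs)
  moreover have "?z \<noteq> 0"
  proof
    assume "?z = 0"
    then have *: "(norm (y v))\<^sup>2 \<le> d * (norm (U v))\<^sup>2" for v
      using positive_part[OF a[OF yA y(2) small]] neg[OF yA y(2)] by blast
    have "norm y \<le> norm (y - x)"
    proof (rule norm_blinfun_bound)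
      fix v
      have "(norm (y v))\<^sup>2 \<le> d * (norm v)\<^sup>2"
        using *[of v] mult_left_mono[OF power_mono[OF norm_U_apply[of v], of 2] d(1)] by simp
      then have "(norm (y v))\<^sup>2 \<le> (norm (y - x) * norm v)\<^sup>2"
        by (simp add: d_def power_mult_distrib)
      then show "norm (y v) \<le> norm (y - x) * norm v"
        by (rule power2_le_imp_le) simp
    qed simp
    then show False using less by simp
  qed
  ultimately show ?thesis by blast
qed

text \<open>Rescaling \<open>x\<close> and \<open>y\<close> by the factor that gives
  \<open>y\<close> norm 1/2 removes the size restriction.\<close>

lemma ideal_meets_subalgebra:
  assumes B: "cstar_algebra B" "U \<in> B" "B \<subseteq> A" and I: "closed_ideal A I"
    and x: "x \<in> I" "is_adjoint x x" and y: "y \<in> B" "is_adjoint y y"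
    and less: "norm (y - x) < norm y"
  shows "\<exists>z\<in>I \<inter> B. z \<noteq> 0"
proof -
  define r where "r = 1 / (2 * norm y)"
  have "norm y > 0" using less norm_ge_zero[of "y - x"] by linarith
  then have r: "r > 0" by (simp add: r_def)
  have "norm (r *\<^sub>R y - r *\<^sub>R x) < norm (r *\<^sub>R y)"
    using r less by (simp flip: scaleR_diff_right)
  moreover have "norm (r *\<^sub>R y) \<le> 1 / 2" using \<open>norm y > 0\<close> by (simp add: r_def)
  moreover have "r *\<^sub>R x \<in> I" "r *\<^sub>R y \<in> B"
    using x y I B op_subspaceD(6) by (auto simp: closed_ideal_def cstar_algebra_def)
  ultimately show ?thesis
    using ideal_meets_subalgebra_aux[OF B I] is_adjoint_scaleR x(2) y(2) by blast
qed

section \<open>Representations: contractivity and closed kernels\<close>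

lemma representation_norm_le:
  fixes \<pi> :: "_ \<Rightarrow> 'k::complex_hilbert_space \<Rightarrow>\<^sub>L 'k"
  assumes \<pi>: "cstar_representation A \<pi>" and b: "b \<in> A" "c \<in> A" "is_adjoint c b"
  shows "norm (\<pi> b) \<le> norm b"
proof -
  have hom: "\<pi> (S + T) = \<pi> S + \<pi> T" "\<pi> (S o\<^sub>L T) = \<pi> S o\<^sub>L \<pi> T"
    "is_adjoint S T \<Longrightarrow> is_adjoint (\<pi> S) (\<pi> T)" "\<pi> (r *\<^sub>R T) = r *\<^sub>R \<pi> T"
    if "S \<in> A" "T \<in> A" for S T r
    using \<pi> that unfolding cstar_representation_def scaleR_eq_scaleC_op by auto
  \<comment> \<open>The root \<open>s\<close> of \<open>U - h\<close> gives
    \<open>U = (s o\<^sub>L s) + (c o\<^sub>L b)\<close>. Applying \<open>\<pi>\<close> and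
    evaluating the form at \<open>v\<close> bounds \<open>norm (\<pi> b v)\<close> by
    \<open>norm (\<pi> U v)\<close>, where \<open>\<pi> U\<close> is a projection.\<close>
  have unit_ball: "norm (\<pi> b) \<le> 1"
    if b: "b \<in> A" "c \<in> A" "is_adjoint c b" and "norm b \<le> 1" for b c
  proof -
    define h where "h = c o\<^sub>L b"
    have h: "h \<in> A" "is_adjoint h h" "norm h \<le> 1"
    proof -
      show "h \<in> A" "is_adjoint h h"
        unfolding h_def using b by (auto intro: mult_mem is_adjoint_compose is_adjoint_sym)
      have "norm h \<le> norm c * norm b" unfolding h_def by (rule norm_blinfun_compose)
      also have "\<dots> \<le> 1 * 1"
        using \<open>norm b \<le> 1\<close> is_adjoint_norm[OF b(3)] by (intro mult_mono) auto
      finally show "norm h \<le> 1" by simp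
    qed
    define s where "s = U - sqrt_defect h"
    have s: "s \<in> A" "s o\<^sub>L s = U - h" "is_adjoint s s"
      using sqrt_complement[OF h(1,3)] h(2) by (auto simp: s_def positive_op_def)
    have "\<pi> U = \<pi> ((s o\<^sub>L s) + h)" by (simp add: s(2))
    also have "\<dots> = (\<pi> s o\<^sub>L \<pi> s) + (\<pi> c o\<^sub>L \<pi> b)"
      using hom(1)[OF mult_mem[OF s(1,1)] h(1)] hom(2)[OF s(1,1)] hom(2)[OF b(2,1)]
      by (simp add: h_def)
    finally have eq: "\<pi> U = (\<pi> s o\<^sub>L \<pi> s) + (\<pi> c o\<^sub>L \<pi> b)" .
    have proj: "is_adjoint (\<pi> U) (\<pi> U)" "\<pi> U o\<^sub>L \<pi> U = \<pi> U"
      using hom(2,3)[of U U] U unit(1)[of U] by auto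
    show ?thesis
    proof (rule norm_blinfun_bound)
      fix v
      have "(norm (\<pi> s v))\<^sup>2 + (norm (\<pi> b v))\<^sup>2 = (norm (\<pi> U v))\<^sup>2"
        using cinner_compose_adjoint[OF hom(3)[OF s(1,1,3)], of v]
          cinner_compose_adjoint[OF hom(3)[OF b(2,1,3)], of v]
          cinner_compose_adjoint[OF proj(1), of v, unfolded proj(2)]
        unfolding eq blinfun.add_left cinner_add_left plus_complex.sel by linarith
      moreover have "(norm (\<pi> U v))\<^sup>2 \<le> (norm v)\<^sup>2"
        by (simp add: power_mono projection_norm_le[OF proj])
      ultimately have "(norm (\<pi> b v))\<^sup>2 \<le> (norm v)\<^sup>2"
        using zero_le_power2[of "norm (\<pi> s v)"] by linarith
      then show "norm (\<pi> b v) \<le> 1 * norm v"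
        unfolding mult_1 by (rule power2_le_imp_le) (rule norm_ge_zero)
    qed simp
  qed
  show ?thesis
  proof (cases "b = 0")
    case True
    have "\<pi> b = 0" using hom(4)[OF b(1,1), of 0] True by simp
    then show ?thesis by simp
  next
    case False
    define r where "r = 1 / norm b"
    have r: "r > 0" using False by (simp add: r_def)
    have "norm (\<pi> (r *\<^sub>R b)) \<le> 1"
      using False b
      by (intro unit_ball[of _ "r *\<^sub>R c"]) (auto intro: subspace is_adjoint_scaleR simp: r_def)
    then show ?thesis
      using False hom(4)[OF b(1,1)] by (simp add: r_def field_simps)
  qed
qed

text \<open>Continuity is not part of \<open>cstar_representation\<close>; closedness comes from
  contractivity, applied to \<open>T - t n\<close> with an adjoint supplied by
  \<open>adj\<close>.\<close>

lemma closed_ideal_kernel: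
  fixes \<pi> :: "_ \<Rightarrow> 'k::complex_hilbert_space \<Rightarrow>\<^sub>L 'k"
  assumes \<pi>: "cstar_representation A \<pi>" and adj: "\<And>T. T \<in> A \<Longrightarrow> \<exists>S\<in>A. is_adjoint S T"
  shows "closed_ideal A {T \<in> A. \<pi> T = 0}"
proof -
  have hom: "\<pi> (S + T) = \<pi> S + \<pi> T" "\<pi> (S o\<^sub>L T) = \<pi> S o\<^sub>L \<pi> T"
    "\<pi> (scaleC_op c T) = scaleC_op c (\<pi> T)"
    if "S \<in> A" "T \<in> A" for S T c
    using \<pi> that unfolding cstar_representation_def by auto
  have z: "scaleC_op c (0 :: 'k \<Rightarrow>\<^sub>L 'k) = 0" for c
    by (rule blinfun_eqI) (simp add: scaleC_op_def)
  have real: "\<pi> (r *\<^sub>R T) = r *\<^sub>R \<pi> T" if "T \<in> A" for r T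
    using hom(3)[OF that that] by (simp add: scaleR_eq_scaleC_op)
  have zero: "\<pi> 0 = 0" using real[OF subspace(2), of 0] by simp
  have "closed {T \<in> A. \<pi> T = 0}"
    unfolding closed_sequential_limits
  proof (intro allI impI)
    fix t T assume t: "(\<forall>n. t n \<in> {T \<in> A. \<pi> T = 0}) \<and> t \<longlonglongrightarrow> T"
    then have T: "T \<in> A"
      using closed_sequentially[OF cstar_algebraD(2)[OF cstar], of t T] by auto
    have "norm (\<pi> T) \<le> norm (T - t n)" for n
    proof -
      have tn: "t n \<in> A" "\<pi> (t n) = 0" using t by auto
      have d: "T - t n \<in> A" by (intro subspace T tn)
      have "\<pi> T = \<pi> (T - t n) + \<pi> (t n)" using hom(1)[OF d tn(1)] by simp
      moreover obtain c where "c \<in> A" "is_adjoint c (T - t n)" using adj[OF d] by blast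
      ultimately show ?thesis using representation_norm_le[OF \<pi> d] tn(2) by simp
    qed
    moreover have "(\<lambda>n. norm (T - t n)) \<longlonglongrightarrow> norm (T - T)"
      using t by (intro tendsto_intros) auto
    ultimately have "norm (\<pi> T) \<le> norm (T - T)"
      by (intro LIMSEQ_le_const) auto
    then show "T \<in> {T \<in> A. \<pi> T = 0}" using T by simp
  qed
  moreover have "op_subspace {T \<in> A. \<pi> T = 0}"
    unfolding op_subspace_def using subspace(1) by (auto simp: subspace(2-5) hom zero z)
  ultimately show ?thesis
    unfolding closed_ideal_def by (auto simp: hom mult_mem)
qed

end


section \<open>Word operators\<close>

lemma cinner_ket: "cinner \<xi> (ket x) = coord \<xi> x"
proof -
  have "cinner \<xi> (ket x) = (\<Sum>\<^sub>\<infinity>y. coord \<xi> y * cnj (if y = x then 1 else 0))"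
    by (simp add: cinner_ell2.rep_eq ket.rep_eq)
  also have "\<dots> = (\<Sum>\<^sub>\<infinity>y\<in>{x}. coord \<xi> y)"
    by (rule infsum_cong_neutral) auto
  finally show ?thesis by simp
qed

lemma norm_ket: "norm (ket x) = 1"
proof -
  have "(norm (ket x))\<^sup>2 = 1"
    unfolding norm_power2_cinner cinner_ket by (simp add: ket.rep_eq)
  then show ?thesis using norm_ge_zero[of "ket x"] unfolding power2_eq_1_iff by linarith
qed

text \<open>The coordinate of \<open>S \<eta>\<close> at \<open>x\<close> is conjugate to
  \<open>cinner (T (ket x)) \<eta>\<close>, so \<open>S\<close> vanishes, and \<open>T\<close> has
  the same norm.\<close>

lemma eq_zero_if_ket_zero:
  assumes "is_adjoint S T" "\<And>x. T (ket x) = 0"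
  shows "T = 0"
proof -
  have "S \<eta> = 0" for \<eta>
  proof (rule coord_inject[THEN iffD1], rule ext)
    fix x
    have "cinner (ket x) (S \<eta>) = cinner (T (ket x)) \<eta>"
      using assms(1) by (simp add: is_adjoint_def)
    then have "cinner (ket x) (S \<eta>) = 0" by (simp add: assms(2))
    then have "cinner (S \<eta>) (ket x) = 0" using cinner_commute[of "S \<eta>" "ket x"] by simp
    then show "coord (S \<eta>) x = coord 0 x" by (simp add: cinner_ket zero_ell2.rep_eq)
  qed
  then have "S = 0" by (intro blinfun_eqI) simp
  then show ?thesis using is_adjoint_norm[OF assms(1)] by simp
qed

lemma mult_indicator_apply_eq_iff: "mult_indicator X \<xi> = \<eta> \<longleftrightarrow> (\<forall>x. indicator X x * coord \<xi> x = coord \<eta> x)"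
  by (metis coord_inject coord_mult_indicator ext)

lemma mult_indicator_Int: "mult_indicator X o\<^sub>L mult_indicator Y = mult_indicator (X \<inter> Y)"
  by (rule blinfun_eqI) (auto simp: coord_mult_indicator indicator_def
      intro!: coord_inject[THEN iffD1] ext)

lemma mult_indicator_Diff:
  "X \<subseteq> Y \<Longrightarrow> mult_indicator (Y - X) = mult_indicator Y - mult_indicator X"
  by (rule blinfun_eqI) (auto simp: blinfun.diff_left coord_mult_indicator minus_ell2.rep_eq
      indicator_def intro!: coord_inject[THEN iffD1] ext)

lemma mult_indicator_adjoint: "is_adjoint (mult_indicator X) (mult_indicator X)"
proof -
  have eq: "indicator X x * coord \<xi> x * cnj (coord \<eta> x)
      = coord \<xi> x * cnj (indicator X x * coord \<eta> x)" for x \<xi> \<eta>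
    by (simp add: indicator_def)
  show ?thesis
    unfolding is_adjoint_def cinner_ell2.rep_eq coord_mult_indicator eq by simp
qed

lemma norm_mult_indicator: "norm (mult_indicator X) \<le> 1"
  by (rule norm_blinfun_bound)
    (simp_all add: projection_norm_le[OF mult_indicator_adjoint] mult_indicator_Int)

lemma mult_indicator_ket: "x \<in> X \<Longrightarrow> mult_indicator X (ket x) = ket x"
  by (auto simp: coord_mult_indicator ket.rep_eq intro!: coord_inject[THEN iffD1] ext)

lemma op_subspace_hull:
  assumes "X \<subseteq> bounded_operators"
  shows "op_subspace (op_subspace hull X)"
proof -
  let ?F = "{V. op_subspace V \<and> X \<subseteq> V}"
  have "bounded_operators \<in> ?F"
    using assms cstar_algebra_bounded_operators by (auto simp: cstar_algebra_def)
  then show ?thesis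
    unfolding hull_def op_subspace_def
    by (intro conjI) (blast dest: op_subspaceD(1) | auto simp: op_subspaceD)+
qed

section \<open>Translation operators on subsets of the group\<close>

locale group_submonoid =
  fixes G :: "('g, 'm) monoid_scheme" (structure) and P
  assumes group: "group G" and submonoid: "submonoid P G"
begin

sublocale group G by (rule group)

lemma submonoid_closed: "\<one> \<in> P" "x \<in> P \<Longrightarrow> y \<in> P \<Longrightarrow> x \<otimes> y \<in> P"
  and carrierI: "x \<in> P \<Longrightarrow> x \<in> carrier G" "P \<subseteq> carrier G"
  using submonoid by (auto simp: submonoid_def)

lemma mem_l_coset_iff:
  "g \<in> carrier G \<Longrightarrow> X \<subseteq> carrier G \<Longrightarrow> x \<in> g <# X \<longleftrightarrow> x \<in> carrier G \<and> inv g \<otimes> x \<in> X"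
  by (auto simp: l_coset_def m_assoc[symmetric] intro!: bexI[of _ "inv g \<otimes> x"])

lemma l_coset_eq_image: "g <# X = (\<lambda>x. g \<otimes> x) ` X"
  by (auto simp: l_coset_def)

lemma mult_inv_cancel_left: "g \<in> carrier G \<Longrightarrow> x \<in> carrier G \<Longrightarrow> g \<otimes> (inv g \<otimes> x) = x"
  "g \<in> carrier G \<Longrightarrow> x \<in> carrier G \<Longrightarrow> inv g \<otimes> (g \<otimes> x) = x"
  by (simp_all add: m_assoc[symmetric])

lemmas l_coset_simps = mem_l_coset_iff mult_inv_cancel_left inv_mult_group m_assoc l_coset_subset_G

text \<open>Nothing in the definition of \<^const>\<open>left_regular\<close> uses that \<open>P\<close> is a submonoid containing
  the element: \<open>shift g X\<close> maps \<open>ket x\<close> to \<open>ket (gx)\<close> for \<open>x\<close> in \<open>X\<close> and to \<open>0\<close> otherwise.\<close>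

abbreviation shift :: "'g \<Rightarrow> 'g set \<Rightarrow> 'g ell2 \<Rightarrow>\<^sub>L 'g ell2" where
  "shift g X \<equiv> left_regular G X g"

lemma coord_shift:
  assumes "g \<in> carrier G" "X \<subseteq> carrier G"
  shows "coord (shift g X \<xi>) x = (if x \<in> g <# X then coord \<xi> (inv g \<otimes> x) else 0)"
proof -
  have "inj_on (\<lambda>x. inv g \<otimes> x) (g <# X)"
    using assms by (auto intro!: inj_onI simp: mem_l_coset_iff inv_solve_left')
  from coord_reindex[OF this, of \<xi>] show ?thesis
    unfolding left_regular_def isometry_fun_def by simp
qed

lemma shift_bounded_operator:
  assumes "g \<in> carrier G" "X \<subseteq> carrier G"
  shows "shift g X \<in> bounded_operators"
  unfolding bounded_operators_def
  by (auto simp: coord_shift[OF assms] scaleC_ell2.rep_eq intro!: coord_inject[THEN iffD1] ext)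

lemma shift_one: "X \<subseteq> carrier G \<Longrightarrow> shift \<one> X = mult_indicator X"
  by (rule blinfun_eqI) (auto simp: coord_shift coord_mult_indicator mem_l_coset_iff indicator_def
      intro!: coord_inject[THEN iffD1] ext)

lemma shift_empty: "g \<in> carrier G \<Longrightarrow> shift g {} = 0"
  by (rule blinfun_eqI) (auto simp: coord_shift zero_ell2.rep_eq l_coset_def
      intro!: coord_inject[THEN iffD1] ext)

text \<open>The composite is defined at the points of \<open>Y\<close> that \<open>h\<close> moves
  into \<open>X\<close>.\<close>

lemma shift_compose:
  assumes "g \<in> carrier G" "h \<in> carrier G" "X \<subseteq> carrier G" "Y \<subseteq> carrier G"
  shows "shift g X o\<^sub>L shift h Y = shift (g \<otimes> h) (Y \<inter> (inv h <# X))"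
proof (rule blinfun_eqI, rule coord_inject[THEN iffD1], rule ext)
  fix \<xi> x
  have sub: "Y \<inter> (inv h <# X) \<subseteq> carrier G" using assms by auto
  have "x \<in> (g \<otimes> h) <# (Y \<inter> (inv h <# X)) \<longleftrightarrow> x \<in> g <# X \<and> inv g \<otimes> x \<in> h <# Y"
    using assms by (auto simp: mem_l_coset_iff[OF m_closed[OF assms(1,2)] sub] l_coset_simps)
  moreover have "x \<in> g <# X \<Longrightarrow> inv h \<otimes> (inv g \<otimes> x) = inv (g \<otimes> h) \<otimes> x"
    using assms by (auto simp: l_coset_simps)
  ultimately show "coord ((shift g X o\<^sub>L shift h Y) \<xi>) x
      = coord (shift (g \<otimes> h) (Y \<inter> (inv h <# X)) \<xi>) x"
    using assms sub by (simp add: coord_shift)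
qed

text \<open>The adjoint is the inverse translation, defined on the image of \<open>X\<close>; the
  inner product is reindexed along left multiplication by \<open>g\<close>.\<close>

lemma shift_adjoint:
  assumes "g \<in> carrier G" "X \<subseteq> carrier G"
  shows "is_adjoint (shift (inv g) (g <# X)) (shift g X)"
  unfolding is_adjoint_def
proof (intro allI)
  fix \<xi> \<eta>
  have gX: "g <# X \<subseteq> carrier G" using assms by (simp add: l_coset_subset_G)
  have inj: "inj_on (\<lambda>x. g \<otimes> x) X"
    using assms by (auto intro!: inj_onI simp: subset_iff)
  have X: "x \<in> inv g <# (g <# X) \<longleftrightarrow> x \<in> X" for x
    using assms gX by (auto simp: l_coset_simps)
  have "cinner (shift g X \<xi>) \<eta> = (\<Sum>\<^sub>\<infinity>x\<in>g <# X. coord \<xi> (inv g \<otimes> x) * cnj (coord \<eta> x))"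
    unfolding cinner_ell2.rep_eq coord_shift[OF assms]
    by (rule infsum_cong_neutral) auto
  also have "\<dots> = (\<Sum>\<^sub>\<infinity>x\<in>X. coord \<xi> (inv g \<otimes> (g \<otimes> x)) * cnj (coord \<eta> (g \<otimes> x)))"
    unfolding l_coset_eq_image by (simp add: infsum_reindex[OF inj] o_def)
  also have "\<dots> = cinner \<xi> (shift (inv g) (g <# X) \<eta>)"
    unfolding cinner_ell2.rep_eq coord_shift[OF inv_closed[OF assms(1)] gX] X
    by (rule infsum_cong_neutral) (use assms in \<open>auto simp: mult_inv_cancel_left subset_iff\<close>)
  finally show "cinner (shift g X \<xi>) \<eta> = cinner \<xi> (shift (inv g) (g <# X) \<eta>)" .
qed

section \<open>Words, their values and constructible right ideals\<close>

abbreviation val :: "'g word \<Rightarrow> 'g" where "val \<equiv> word_val G"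
abbreviation K :: "'g word \<Rightarrow> 'g set" where "K \<equiv> constructible G P"
abbreviation word_op :: "'g word \<Rightarrow> 'g ell2 \<Rightarrow>\<^sub>L 'g ell2" where
  "word_op \<alpha> \<equiv> shift (val \<alpha>) (K \<alpha>)"
abbreviation word_rev :: "'g word \<Rightarrow> 'g word" where "word_rev \<alpha> \<equiv> rev (map prod.swap \<alpha>)"

lemma words_simps [simp]:
  "[] \<in> words P" "pq # \<alpha> \<in> words P \<longleftrightarrow> fst pq \<in> P \<and> snd pq \<in> P \<and> \<alpha> \<in> words P"
  "\<alpha> @ \<beta> \<in> words P \<longleftrightarrow> \<alpha> \<in> words P \<and> \<beta> \<in> words P"
  by (auto simp: words_def mem_Times_iff)

lemma word_rev_words: "\<alpha> \<in> words P \<Longrightarrow> word_rev \<alpha> \<in> words P"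
  by (induction \<alpha>) auto

lemma val_closed: "\<alpha> \<in> words P \<Longrightarrow> val \<alpha> \<in> carrier G"
  by (induction \<alpha>) (auto simp: carrierI)

lemma K_subset: "K \<alpha> \<subseteq> P" "K \<alpha> \<subseteq> carrier G"
proof -
  show "K \<alpha> \<subseteq> P" by (induction \<alpha>) auto
  then show "K \<alpha> \<subseteq> carrier G" using carrierI(2) by blast
qed

text \<open>Iterated along the word, this says that \<open>x\<close> and its translates by the
  values of all suffixes lie in \<open>P\<close>: \<open>x\<close> follows a path inside
  \<open>P\<close>.\<close>

lemma mem_K_Cons_iff:
  assumes "pq # \<alpha> \<in> words P"
  shows "x \<in> K (pq # \<alpha>) \<longleftrightarrow> x \<in> K \<alpha> \<and> val (pq # \<alpha>) \<otimes> x \<in> P"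
proof -
  have v: "val (pq # \<alpha>) \<in> carrier G" by (rule val_closed[OF assms])
  have "x \<in> inv (val (pq # \<alpha>)) <# P \<longleftrightarrow> x \<in> carrier G \<and> val (pq # \<alpha>) \<otimes> x \<in> P"
    unfolding mem_l_coset_iff[OF inv_closed[OF v] carrierI(2)] inv_inv[OF v] ..
  then show ?thesis
    using K_subset(2)[of \<alpha>] unfolding constructible.simps by blast
qed

lemma val_mult_K:
  assumes "\<alpha> \<in> words P" "x \<in> K \<alpha>"
  shows "val \<alpha> \<otimes> x \<in> P"
proof (cases \<alpha>)
  case Nil
  then show ?thesis using assms carrierI by simp
next
  case (Cons pq \<beta>)
  then show ?thesis using assms mem_K_Cons_iff by blast
qed

text \<open>Right multiplication by \<open>p\<close> commutes with the left translations along the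
  path and maps \<open>P\<close> into itself.\<close>

lemma K_right_ideal: "\<alpha> \<in> words P \<Longrightarrow> x \<in> K \<alpha> \<Longrightarrow> p \<in> P \<Longrightarrow> x \<otimes> p \<in> K \<alpha>"
proof (induction \<alpha>)
  case Nil
  then show ?case by (simp add: submonoid_closed)
next
  case (Cons pq \<alpha>)
  have x: "x \<in> K \<alpha>" "val (pq # \<alpha>) \<otimes> x \<in> P"
    using Cons.prems mem_K_Cons_iff by blast+
  then have "(val (pq # \<alpha>) \<otimes> x) \<otimes> p \<in> P" using Cons.prems submonoid_closed(2) by blast
  then have "val (pq # \<alpha>) \<otimes> (x \<otimes> p) \<in> P"
    using val_closed[OF Cons.prems(1)] x(1) K_subset(2)[of \<alpha>] Cons.prems(3) carrierI(1)[of p]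
    by (metis m_assoc subsetD)
  moreover have "x \<otimes> p \<in> K \<alpha>" using Cons x by simp
  ultimately show ?case using mem_K_Cons_iff[OF Cons.prems(1)] by blast
qed

lemma val_append: "\<alpha> \<in> words P \<Longrightarrow> \<beta> \<in> words P \<Longrightarrow> val (\<alpha> @ \<beta>) = val \<alpha> \<otimes> val \<beta>"
  by (induction \<alpha>) (auto simp: m_assoc val_closed carrierI)

text \<open>The path of \<open>x\<close> along \<open>\<alpha> @ \<beta>\<close> runs through
  \<open>\<beta>\<close> first and continues with \<open>\<alpha>\<close> from
  \<open>val \<beta> \<otimes> x\<close>.\<close>

lemma mem_K_append_iff:
  assumes "\<alpha> \<in> words P" "\<beta> \<in> words P"
  shows "x \<in> K (\<alpha> @ \<beta>) \<longleftrightarrow> x \<in> K \<beta> \<and> val \<beta> \<otimes> x \<in> K \<alpha>"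
  using assms(1)
proof (induction \<alpha>)
  case Nil
  then show ?case using val_mult_K[OF assms(2)] by auto
next
  case (Cons pq \<alpha>)
  have "val (pq # \<alpha> @ \<beta>) \<otimes> x = val (pq # \<alpha>) \<otimes> (val \<beta> \<otimes> x)" if "x \<in> K \<beta>"
    using val_append[OF Cons.prems assms(2)] that K_subset(2)[of \<beta>]
      val_closed[OF Cons.prems] val_closed[OF assms(2)]
    by (metis append_Cons m_assoc subsetD)
  moreover have "pq # \<alpha> @ \<beta> \<in> words P" using Cons.prems assms by simp
  ultimately show ?case
    using Cons mem_K_Cons_iff[of pq "\<alpha> @ \<beta>" x] mem_K_Cons_iff[of pq \<alpha> "val \<beta> \<otimes> x"]
    by auto
qed

lemma word_op_append:
  assumes "\<alpha> \<in> words P" "\<beta> \<in> words P"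
  shows "word_op \<alpha> o\<^sub>L word_op \<beta> = word_op (\<alpha> @ \<beta>)"
proof -
  have "K (\<alpha> @ \<beta>) = K \<beta> \<inter> (inv (val \<beta>) <# K \<alpha>)"
    using K_subset(2)[of \<beta>]
    by (auto simp: mem_K_append_iff[OF assms]
        mem_l_coset_iff[OF inv_closed[OF val_closed[OF assms(2)]] K_subset(2)]
        inv_inv[OF val_closed[OF assms(2)]])
  then show ?thesis
    using assms by (simp add: shift_compose val_closed K_subset val_append)
qed

text \<open>The reversed word runs through the same path backwards, so it is defined exactly at the
  end points of the paths along \<open>\<alpha>\<close>.\<close>

lemma word_rev:
  assumes "\<alpha> \<in> words P"
  shows "val (word_rev \<alpha>) = inv (val \<alpha>)" "K (word_rev \<alpha>) = val \<alpha> <# K \<alpha>"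
proof -
  have "val (word_rev \<alpha>) = inv (val \<alpha>) \<and>
      (\<forall>x\<in>carrier G. x \<in> K (word_rev \<alpha>) \<longleftrightarrow> inv (val \<alpha>) \<otimes> x \<in> K \<alpha>)"
    using assms
  proof (induction \<alpha>)
    case (Cons pq \<alpha>)
    obtain p q where pq: "pq = (p, q)" by force
    note mem = carrierI(1)
    have w: "p \<in> P" "q \<in> P" "\<alpha> \<in> words P" "word_rev \<alpha> \<in> words P" "[(q, p)] \<in> words P"
      using Cons.prems word_rev_words[of \<alpha>] by (auto simp: pq)
    have v: "val \<alpha> \<in> carrier G" "val (pq # \<alpha>) \<in> carrier G"
      using w by (auto simp: pq val_closed mem)
    have IH: "val (word_rev \<alpha>) = inv (val \<alpha>)"
      "\<And>x. x \<in> carrier G \<Longrightarrow> x \<in> K (word_rev \<alpha>) \<longleftrightarrow> inv (val \<alpha>) \<otimes> x \<in> K \<alpha>"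
      using Cons.IH w by auto
    have val1: "val [(q, p)] = inv q \<otimes> p" using w by (simp add: mem)
    have "val (word_rev (pq # \<alpha>)) = inv (val (pq # \<alpha>))"
      using val_append[OF w(4,5)] w v IH(1) by (simp add: pq inv_mult_group mem m_assoc)
    moreover have "x \<in> K (word_rev (pq # \<alpha>)) \<longleftrightarrow> inv (val (pq # \<alpha>)) \<otimes> x \<in> K (pq # \<alpha>)"
      if x: "x \<in> carrier G" for x
    proof -
      let ?y = "inv (val (pq # \<alpha>)) \<otimes> x"
      have y: "inv (val \<alpha>) \<otimes> (inv q \<otimes> p \<otimes> x) = ?y"
        using w v(1) x by (simp add: pq inv_mult_group mem m_assoc)
      have y': "val \<alpha> \<otimes> ?y = inv q \<otimes> p \<otimes> x"
        unfolding y[symmetric] using w v(1) x by (simp add: mult_inv_cancel_left mem)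
      have "x \<in> K (word_rev (pq # \<alpha>)) \<longleftrightarrow> x \<in> P \<and> inv q \<otimes> p \<otimes> x \<in> P \<and> ?y \<in> K \<alpha>"
        using mem_K_append_iff[OF w(4,5), of x] mem_K_Cons_iff[OF w(5), of x] IH(2) y x w
        by (auto simp: pq val1 mem)
      \<comment> \<open>The dropped condition is automatic: the element is
        \<open>val \<alpha> \<otimes> ?y\<close>, which is in \<open>P\<close> once
        \<open>?y \<in> K \<alpha>\<close>.\<close>
      also have "\<dots> \<longleftrightarrow> x \<in> P \<and> ?y \<in> K \<alpha>"
        using val_mult_K[OF w(3), of ?y] y' by auto
      also have "\<dots> \<longleftrightarrow> ?y \<in> K (pq # \<alpha>)"
        unfolding mem_K_Cons_iff[OF Cons.prems]
        using mult_inv_cancel_left(1)[OF v(2) x] by auto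
      finally show ?thesis .
    qed
    ultimately show ?case by blast
  qed (auto simp: carrierI)
  then show "val (word_rev \<alpha>) = inv (val \<alpha>)" "K (word_rev \<alpha>) = val \<alpha> <# K \<alpha>"
    using K_subset(2)[of "word_rev \<alpha>"] mem_l_coset_iff[OF val_closed[OF assms] K_subset(2)]
    by blast+
qed

lemma word_op_adjoint: "\<alpha> \<in> words P \<Longrightarrow> is_adjoint (word_op (word_rev \<alpha>)) (word_op \<alpha>)"
  using shift_adjoint[OF val_closed K_subset(2)] by (simp add: word_rev)

text \<open>Following \<open>\<alpha>\<close> and then retracing it returns every point of
  \<open>K \<alpha>\<close> to itself. So every \<open>K \<alpha>\<close> is the ideal of a word of
  value \<open>\<one>\<close>, and its indicator lies in the diagonal algebra.\<close>

lemma K_word_rev_append: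
  assumes "\<alpha> \<in> words P"
  shows "K (word_rev \<alpha> @ \<alpha>) = K \<alpha>" "val (word_rev \<alpha> @ \<alpha>) = \<one>"
proof -
  have "val \<alpha> \<otimes> x \<in> val \<alpha> <# K \<alpha>" if "x \<in> K \<alpha>" for x
    using that by (auto simp: l_coset_def)
  then show "K (word_rev \<alpha> @ \<alpha>) = K \<alpha>"
    by (auto simp: mem_K_append_iff[OF word_rev_words[OF assms] assms] word_rev[OF assms])
  show "val (word_rev \<alpha> @ \<alpha>) = \<one>"
    using assms by (simp add: val_append word_rev_words word_rev val_closed)
qed

section \<open>The linear span of the word operators is a self-adjoint algebra\<close>

definition word_span :: "('g ell2 \<Rightarrow>\<^sub>L 'g ell2) set" where
  "word_span = op_subspace hull (word_op ` words P)"

lemma word_ops_bounded: "word_op ` words P \<subseteq> bounded_operators"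
  using shift_bounded_operator[OF val_closed K_subset(2)] by blast

lemma op_subspace_word_span: "op_subspace word_span"
  unfolding word_span_def by (rule op_subspace_hull[OF word_ops_bounded])

lemma word_op_mem_span: "\<alpha> \<in> words P \<Longrightarrow> word_op \<alpha> \<in> word_span"
  unfolding word_span_def by (blast intro: hull_inc)

lemma word_span_induct [consumes 1, case_names word zero add scale]:
  assumes "T \<in> word_span" and word: "\<And>\<alpha>. \<alpha> \<in> words P \<Longrightarrow> Q (word_op \<alpha>)" and "Q 0"
    and add: "\<And>S T. S \<in> word_span \<Longrightarrow> T \<in> word_span \<Longrightarrow> Q S \<Longrightarrow> Q T \<Longrightarrow> Q (S + T)"
    and scale: "\<And>c T. T \<in> word_span \<Longrightarrow> Q T \<Longrightarrow> Q (scaleC_op c T)"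
  shows "Q T"
proof -
  note sub = op_subspaceD[OF op_subspace_word_span]
  \<comment> \<open>Membership in the span is built into the set because \<open>op_subspace\<close>
    demands a subset of \<open>bounded_operators\<close>.\<close>
  have "op_subspace {T \<in> word_span. Q T}"
    unfolding op_subspace_def using sub(1) \<open>Q 0\<close> by (auto simp: add scale sub(2,3,5))
  moreover have "word_op ` words P \<subseteq> {T \<in> word_span. Q T}"
    using word word_op_mem_span by blast
  ultimately have "word_span \<subseteq> {T \<in> word_span. Q T}"
    using hull_minimal[of "word_op ` words P" _ op_subspace] unfolding word_span_def by blast
  then show ?thesis using assms(1) by blast
qed

lemma scaleC_op_compose:
  "scaleC_op c S o\<^sub>L T = scaleC_op c (S o\<^sub>L T)"
  "S \<in> bounded_operators \<Longrightarrow> S o\<^sub>L scaleC_op c T = scaleC_op c (S o\<^sub>L T)"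
  by (auto intro!: blinfun_eqI simp: bounded_operators_def)

lemma word_span_compose:
  assumes "S \<in> word_span" "T \<in> word_span"
  shows "S o\<^sub>L T \<in> word_span"
  using assms
proof (induction S rule: word_span_induct)
  case (word \<alpha>)
  from word(2) show ?case
  proof (induction T rule: word_span_induct)
    case (word \<beta>)
    then show ?case using \<open>\<alpha> \<in> words P\<close> by (simp add: word_op_append word_op_mem_span)
  next
    case (scale c T)
    have "word_op \<alpha> \<in> bounded_operators" using word_ops_bounded \<open>\<alpha> \<in> words P\<close> by blast
    then show ?case
      using scale by (simp add: scaleC_op_compose op_subspaceD[OF op_subspace_word_span])
  qed (simp_all add: op_subspaceD[OF op_subspace_word_span] compose_simps)
qed (simp_all add: op_subspaceD[OF op_subspace_word_span] compose_simps scaleC_op_compose)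

lemma word_span_adjoint: "T \<in> word_span \<Longrightarrow> \<exists>S\<in>word_span. is_adjoint S T"
proof (induction T rule: word_span_induct)
  case (word \<alpha>)
  then show ?case using word_op_adjoint word_op_mem_span word_rev_words by blast
next
  case zero
  then show ?case using op_subspaceD(2)[OF op_subspace_word_span] is_adjoint_zero by blast
next
  case (add S T)
  then show ?case using op_subspaceD(3)[OF op_subspace_word_span] is_adjoint_add by blast
next
  case (scale c T)
  then show ?case using op_subspaceD(5)[OF op_subspace_word_span] is_adjoint_scaleC_op by blast
qed

lemmas closure_word_span =
  closure_cstar_algebra[OF op_subspace_word_span word_span_compose word_span_adjoint]

section \<open>The Toeplitz algebra and its subalgebra of the units\<close>

abbreviation T where "T \<equiv> toeplitz_algebra G P"
abbreviation B where "B \<equiv> units_crossed_product G P"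
abbreviation U where "U \<equiv> mult_indicator P"

lemmas cstar_T = cstar_algebra_toeplitz[OF group submonoid]
lemmas cstar_B = cstar_algebra_units_crossed_product[OF group submonoid]
lemmas T_closed = op_subspaceD[OF cstar_algebraD(1)[OF cstar_T]] cstar_algebraD(3,4)[OF cstar_T]
lemmas B_closed = op_subspaceD[OF cstar_algebraD(1)[OF cstar_B]] cstar_algebraD(3,4)[OF cstar_B]

lemma left_regular_mem: "p \<in> P \<Longrightarrow> left_regular G P p \<in> T"
  unfolding toeplitz_algebra_def by (blast intro: hull_inc)

text \<open>The closure is a \<open>cstar_algebra\<close>, and the generator
  \<open>L\<^sub>p\<close> is the operator of the word \<open>(\<one>, p)\<close>.\<close>

lemma T_subset: "T \<subseteq> closure word_span"
  unfolding toeplitz_algebra_def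
proof (rule hull_minimal)
  show "left_regular G P ` P \<subseteq> closure word_span"
  proof
    fix L assume "L \<in> left_regular G P ` P"
    then obtain p where p: "p \<in> P" "L = left_regular G P p" by blast
    have w: "[(\<one>, p)] \<in> words P" using p by (simp add: submonoid_closed)
    have "val [(\<one>, p)] = p" using p by (simp add: carrierI)
    moreover have "K [(\<one>, p)] = P"
      using submonoid_closed(2)[OF p(1)]
      unfolding set_eq_iff mem_K_Cons_iff[OF w] \<open>val [(\<one>, p)] = p\<close> by auto
    ultimately have "L = word_op [(\<one>, p)]" by (simp only: p)
    then show "L \<in> closure word_span"
      using word_op_mem_span[OF w] closure_subset by auto
  qed
qed (rule closure_word_span)

text \<open>Existence of the adjoint comes from the closure of the span, membership from
  \<open>cstar_algebra\<close>.\<close>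

lemma T_adjoint: "S \<in> T \<Longrightarrow> \<exists>R\<in>T. is_adjoint R S"
  using closure_word_span(2)[of S] T_subset T_closed(8)[of S] by auto

text \<open>The operator of a single pair \<open>(p, q)\<close> is the adjoint of
  \<open>L\<^sub>p\<close> composed with \<open>L\<^sub>q\<close>; longer words are products of
  these.\<close>

lemma word_op_mem_T: "\<alpha> \<in> words P \<Longrightarrow> word_op \<alpha> \<in> T"
proof (induction \<alpha>)
  case Nil
  then show ?case using left_regular_mem submonoid_closed by simp
next
  case (Cons pq \<alpha>)
  obtain p q where pq: "pq = (p, q)" by force
  have w: "p \<in> P" "q \<in> P" "\<alpha> \<in> words P" "[pq] \<in> words P" using Cons.prems by (auto simp: pq)
  note car = carrierI(1)[OF w(1)] carrierI(1)[OF w(2)]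
  have sub: "p <# P \<subseteq> carrier G" using car carrierI(2) by (simp add: l_coset_subset_G)
  have val1: "val [pq] = inv p \<otimes> q" using car by (simp add: pq)
  have "x \<in> K [pq] \<longleftrightarrow> x \<in> P \<inter> (inv q <# (p <# P))" for x
    using mem_K_Cons_iff[OF w(4), of x] car carrierI(1)[of x] val1
      mem_l_coset_iff[OF inv_closed[OF car(2)] sub, of x]
      mem_l_coset_iff[OF car(1) carrierI(2), of "q \<otimes> x"]
    by (auto simp: m_assoc)
  then have "word_op [pq] = shift (inv p) (p <# P) o\<^sub>L shift q P"
    using car carrierI(2) sub val1 by (auto simp: shift_compose intro!: arg_cong2[where f = "\<lambda>X g. shift g X"])
  moreover have "shift (inv p) (p <# P) \<in> T"
    by (rule T_closed(8)[OF left_regular_mem[OF w(1)] shift_adjoint[OF car(1) carrierI(2)]])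
  ultimately have "word_op [pq] \<in> T"
    using T_closed(7) left_regular_mem[OF w(2)] by simp
  then have "word_op [pq] o\<^sub>L word_op \<alpha> \<in> T"
    using Cons.IH[OF w(3)] by (rule T_closed(7))
  then show ?case using word_op_append[OF w(4,3)] by simp
qed

lemma left_regular_mem_B: "u \<in> P \<Longrightarrow> inv u \<in> P \<Longrightarrow> left_regular G P u \<in> B"
proof -
  assume u: "u \<in> P" "inv u \<in> P"
  then have "u \<in> unit_group G P"
    using carrierI by (auto simp: unit_group_def SET_INV_def intro!: bexI[of _ "inv u"])
  then show ?thesis
    unfolding units_crossed_product_def by (blast intro: hull_inc)
qed

lemma U_mem: "U \<in> B" "U \<in> T"
  using left_regular_mem_B[of \<one>] left_regular_mem[of \<one>] shift_one[OF carrierI(2)] submonoid_closed(1)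
  by auto

lemma mult_indicator_K_mem_B:
  assumes "\<alpha> \<in> words P"
  shows "mult_indicator (K \<alpha>) \<in> B"
proof -
  let ?X = "{mult_indicator (K \<beta>) | \<beta>. \<beta> \<in> words P \<and> val \<beta> = \<one>}"
  have "word_rev \<alpha> @ \<alpha> \<in> words P" using assms word_rev_words by simp
  then have "mult_indicator (K (word_rev \<alpha> @ \<alpha>)) \<in> ?X"
    using K_word_rev_append(2)[OF assms] by blast
  then have "mult_indicator (K \<alpha>) \<in> op_subspace hull ?X"
    unfolding K_word_rev_append(1)[OF assms] by (rule hull_inc)
  then have "mult_indicator (K \<alpha>) \<in> diagonal_algebra G P"
    unfolding diagonal_algebra_def using closure_subset by blast
  then show ?thesis
    unfolding units_crossed_product_def by (blast intro: hull_inc)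
qed

lemma B_subset_T: "B \<subseteq> T"
  unfolding units_crossed_product_def
proof (rule hull_minimal)
  have "mult_indicator (K \<beta>) \<in> T" if "\<beta> \<in> words P" "val \<beta> = \<one>" for \<beta>
    using word_op_mem_T[OF that(1)] shift_one[OF K_subset(2), of \<beta>] that(2) by simp
  then have "diagonal_algebra G P \<subseteq> T"
    unfolding diagonal_algebra_def using cstar_algebraD(1,2)[OF cstar_T]
    by (intro closure_minimal hull_minimal) auto
  then show "diagonal_algebra G P \<union> left_regular G P ` unit_group G P \<subseteq> T"
    using left_regular_mem by (auto simp: unit_group_def)
qed (rule cstar_T)

text \<open>\<open>U\<close> is the operator of the empty word, so it is neutral on the span;
  neutrality is a closed condition and passes to the closure.\<close>

lemma U_unit:
  assumes "S \<in> T"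
  shows "U o\<^sub>L S = S" "S o\<^sub>L U = S"
proof -
  have word: "U o\<^sub>L word_op \<alpha> = word_op \<alpha> \<and> word_op \<alpha> o\<^sub>L U = word_op \<alpha>" if "\<alpha> \<in> words P" for \<alpha>
    using word_op_append[of "[]" \<alpha>] word_op_append[of \<alpha> "[]"] that
    by (simp add: shift_one[OF carrierI(2)])
  have "U o\<^sub>L S = S \<and> S o\<^sub>L U = S" if "S \<in> word_span" for S
    using that
    by (induction S rule: word_span_induct)
      (simp_all add: word compose_simps scaleC_op_compose mult_indicator_bounded_operator)
  then have "word_span \<subseteq> {S. U o\<^sub>L S = S} \<inter> {S. S o\<^sub>L U = S}" by blast
  moreover have "closed ({S. U o\<^sub>L S = S} \<inter> {S. S o\<^sub>L U = S})"
    by (intro closed_Int closed_Collect_eq continuous_compose_left continuous_compose_right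
        continuous_on_id)
  ultimately have "closure word_span \<subseteq> {S. U o\<^sub>L S = S} \<inter> {S. S o\<^sub>L U = S}"
    by (rule closure_minimal)
  then show "U o\<^sub>L S = S" "S o\<^sub>L U = S" using T_subset assms by blast+
qed

sublocale unital_cstar_algebra T U
  by unfold_locales (rule cstar_T U_mem mult_indicator_adjoint U_unit, assumption?)+

section \<open>Compression of word operators into the subalgebra of the units\<close>

text \<open>A constructible right ideal other than \<open>P\<close> does not contain \<open>\<one>\<close>.  Hence cutting down by the
  complements of \<open>K(\<alpha>)\<close> and of its translate by the value of \<open>\<alpha>\<close> kills the operator of \<open>\<alpha>\<close> and
  keeps \<open>ket \<one>\<close>, unless both are \<open>P\<close>; then the value of \<open>\<alpha>\<close> is a unit.\<close>

lemma cut_down_word: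
  assumes \<alpha>: "\<alpha> \<in> words P"
  shows "\<exists>X\<subseteq>P. \<one> \<in> X \<and> mult_indicator X \<in> B \<and>
    mult_indicator X o\<^sub>L (word_op \<alpha> o\<^sub>L mult_indicator X) \<in> B"
proof -
  have one: "K \<beta> = P" if "\<beta> \<in> words P" "\<one> \<in> K \<beta>" for \<beta>
    using K_right_ideal[OF that] K_subset(1)[of \<beta>] carrierI by force
  have diff: "P - K \<beta> \<subseteq> P \<and> \<one> \<in> P - K \<beta> \<and> mult_indicator (P - K \<beta>) \<in> B"
    if "\<beta> \<in> words P" "K \<beta> \<noteq> P" for \<beta>
    using that one submonoid_closed(1) mult_indicator_K_mem_B U_mem(1)
    by (auto simp: mult_indicator_Diff[OF K_subset(1)] intro: B_closed)
  note v = val_closed[OF \<alpha>]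
  have sub: "P - X \<subseteq> carrier G" for X using carrierI(2) by blast
  consider (right) "K \<alpha> \<noteq> P" | (left) "K (word_rev \<alpha>) \<noteq> P"
    | (unit) "K \<alpha> = P" "K (word_rev \<alpha>) = P" by blast
  then show ?thesis
  proof cases
    case right
    let ?X = "P - K \<alpha>"
    have "?X \<inter> (inv \<one> <# K \<alpha>) = {}"
      using mem_l_coset_iff[OF one_closed K_subset(2)] K_subset(2)[of \<alpha>] by auto
    then have "word_op \<alpha> o\<^sub>L mult_indicator ?X = 0"
      using shift_compose[OF v one_closed K_subset(2) sub] v
      by (simp add: shift_one[OF sub] shift_empty)
    then show ?thesis using diff[OF \<alpha> right] by (intro exI[of _ ?X]) (simp add: B_closed)
  next
    case left
    let ?X = "P - K (word_rev \<alpha>)"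
    have "val \<alpha> \<otimes> x \<in> val \<alpha> <# K \<alpha>" if "x \<in> K \<alpha>" for x
      using that by (auto simp: l_coset_def)
    then have "K \<alpha> \<inter> (inv (val \<alpha>) <# ?X) = {}"
      using mem_l_coset_iff[OF inv_closed[OF v] sub] v by (auto simp: word_rev[OF \<alpha>])
    then have "mult_indicator ?X o\<^sub>L word_op \<alpha> = 0"
      using shift_compose[OF one_closed v sub K_subset(2)] v
      by (simp add: shift_one[OF sub] shift_empty)
    then have "mult_indicator ?X o\<^sub>L (word_op \<alpha> o\<^sub>L mult_indicator ?X) = 0"
      by (simp flip: blinfun_compose_assoc)
    then show ?thesis
      using diff[OF word_rev_words[OF \<alpha>] left] by (intro exI[of _ ?X]) (simp add: B_closed)
  next
    case unit
    have "val \<alpha> \<in> P"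
      using val_mult_K[OF \<alpha>, of \<one>] unit submonoid_closed(1) v by simp
    moreover have "inv (val \<alpha>) \<in> P"
      using val_mult_K[OF word_rev_words[OF \<alpha>], of \<one>] unit submonoid_closed(1) v
      by (simp add: word_rev(1)[OF \<alpha>])
    ultimately have "word_op \<alpha> \<in> B" using left_regular_mem_B unit by simp
    then show ?thesis
      using U_mem(1) submonoid_closed(1) by (intro exI[of _ P]) (simp add: B_closed)
  qed
qed

text \<open>For a sum the two sets are intersected. A projection for a smaller set absorbs the
  larger one, so a compression that is already in \<open>B\<close> stays there when \<open>X\<close>
  shrinks.\<close>

lemma cut_down:
  assumes "b \<in> word_span"
  shows "\<exists>X\<subseteq>P. \<one> \<in> X \<and> mult_indicator X \<in> B \<and>
    mult_indicator X o\<^sub>L (b o\<^sub>L mult_indicator X) \<in> B"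
  using assms
proof (induction b rule: word_span_induct)
  case (word \<alpha>)
  then show ?case by (rule cut_down_word)
next
  case zero
  then show ?case
    using U_mem(1) submonoid_closed(1) by (intro exI[of _ P]) (simp add: B_closed)
next
  case (scale c b)
  then obtain X where X: "X \<subseteq> P" "\<one> \<in> X" "mult_indicator X \<in> B"
    "mult_indicator X o\<^sub>L (b o\<^sub>L mult_indicator X) \<in> B" by blast
  then show ?case
    using B_closed(5)[OF X(4), of c]
    by (intro exI[of _ X]) (simp add: scaleC_op_compose mult_indicator_bounded_operator)
next
  case (add b c)
  obtain X where X: "X \<subseteq> P" "\<one> \<in> X" "mult_indicator X \<in> B"
    "mult_indicator X o\<^sub>L (b o\<^sub>L mult_indicator X) \<in> B" using add by blast
  obtain Y where Y: "Y \<subseteq> P" "\<one> \<in> Y" "mult_indicator Y \<in> B"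
    "mult_indicator Y o\<^sub>L (c o\<^sub>L mult_indicator Y) \<in> B" using add by blast
  have mono: "mult_indicator (X \<inter> Y) o\<^sub>L (d o\<^sub>L mult_indicator (X \<inter> Y)) \<in> B"
    if "Z \<in> {X, Y}" "mult_indicator Z o\<^sub>L (d o\<^sub>L mult_indicator Z) \<in> B" for Z d
  proof -
    have ZZ: "mult_indicator (X \<inter> Y) = mult_indicator (X \<inter> Y) o\<^sub>L mult_indicator Z"
      "mult_indicator (X \<inter> Y) = mult_indicator Z o\<^sub>L mult_indicator (X \<inter> Y)"
      using that(1) by (auto simp: mult_indicator_Int Int_ac intro!: arg_cong[of _ _ mult_indicator])
    have "mult_indicator (X \<inter> Y) o\<^sub>L (d o\<^sub>L mult_indicator (X \<inter> Y)) =
        mult_indicator (X \<inter> Y) o\<^sub>L ((mult_indicator Z o\<^sub>L (d o\<^sub>L mult_indicator Z))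
          o\<^sub>L mult_indicator (X \<inter> Y))"
      by (metis ZZ blinfun_compose_assoc)
    moreover have "mult_indicator (X \<inter> Y) \<in> B"
      using B_closed(7)[OF X(3) Y(3)] by (simp add: mult_indicator_Int)
    ultimately show ?thesis using that(2) by (simp add: B_closed(7))
  qed
  have "mult_indicator (X \<inter> Y) o\<^sub>L ((b + c) o\<^sub>L mult_indicator (X \<inter> Y)) \<in> B"
    unfolding compose_simps using mono[of X b] mono[of Y c] X(4) Y(4) by (simp add: B_closed(3))
  moreover have "mult_indicator (X \<inter> Y) \<in> B"
    using B_closed(7)[OF X(3) Y(3)] by (simp add: mult_indicator_Int)
  ultimately show ?case
    using X Y by (intro exI[of _ "X \<inter> Y"]) auto
qed

section \<open>Nonzero ideals and faithful representations\<close>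

lemma ideal_meets_units_crossed_product:
  assumes I: "closed_ideal T I" "I \<noteq> {0}"
  shows "\<exists>z\<in>I \<inter> B. z \<noteq> 0"
proof -
  have IT: "I \<subseteq> T" "op_subspace I" "\<And>S R. S \<in> T \<Longrightarrow> R \<in> I \<Longrightarrow> S o\<^sub>L R \<in> I"
    "\<And>S R. S \<in> T \<Longrightarrow> R \<in> I \<Longrightarrow> R o\<^sub>L S \<in> I"
    using I(1) by (auto simp: closed_ideal_def)
  obtain a0 where a0: "a0 \<in> I" "a0 \<noteq> 0" using I(2) op_subspaceD(2)[OF IT(2)] by blast
  \<comment> \<open>Off \<open>P\<close> the basis vectors are killed by \<open>U\<close>, hence by
    \<open>a0\<close>, so a nonzero \<open>a0\<close> must act nontrivially on some
    \<open>ket p\<close> with \<open>p\<close> in \<open>P\<close>.\<close>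
  have "\<exists>p\<in>P. a0 (ket p) \<noteq> 0"
  proof (rule ccontr)
    assume "\<not> ?thesis"
    moreover have "U (ket x) = 0" if "x \<notin> P" for x
      using that by (auto simp: mult_indicator_apply_eq_iff ket.rep_eq zero_ell2.rep_eq)
    then have "a0 (ket x) = 0" if "x \<notin> P" for x
      using that apply_U[of a0 "ket x"] a0 IT(1) by (auto simp: subset_iff)
    ultimately have "a0 (ket x) = 0" for x by blast
    then show False using eq_zero_if_ket_zero T_adjoint a0 IT(1) by blast
  qed
  then obtain p where p: "p \<in> P" "a0 (ket p) \<noteq> 0" by blast
  \<comment> \<open>\<open>L\<^sub>p\<close> maps \<open>ket \<one>\<close> to \<open>ket p\<close>,
    which moves the nonvanishing to the vector \<open>ket \<one>\<close> that all the projections of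
    \<open>cut_down\<close> fix.\<close>
  define a1 where "a1 = a0 o\<^sub>L left_regular G P p"
  have a1: "a1 \<in> I" unfolding a1_def by (intro IT left_regular_mem p a0)
  have "a1 (ket \<one>) = a0 (ket p)"
    using left_regular_ket[OF group submonoid p(1) submonoid_closed(1)] p(1)
    by (simp add: a1_def carrierI)
  then have c: "0 < (norm (a1 (ket \<one>)))\<^sup>2" using p(2) by simp
  obtain a1' where a1': "a1' \<in> T" "is_adjoint a1' a1" using T_adjoint a1 IT(1) by blast
  define a where "a = a1' o\<^sub>L a1"
  define c where "c = (norm (a1 (ket \<one>)))\<^sup>2"
  have a: "a \<in> I" "is_adjoint a a" "Re (cinner (a (ket \<one>)) (ket \<one>)) = c"
    unfolding a_def c_def using a1 a1' cinner_compose_adjoint[OF a1'(2)]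
    by (auto intro: IT is_adjoint_compose is_adjoint_sym)
  \<comment> \<open>The tolerance \<open>c / 2\<close> suffices: \<open>c \<le> norm x\<close> and
    \<open>norm (y - x) < c / 2\<close> give \<open>norm (y - x) < norm y\<close>.\<close>
  obtain b where b: "b \<in> word_span" "norm (b - a) < c / 2"
    using T_subset a(1) IT(1) c closure_approachable[of a word_span]
    by (metis c_def dist_norm half_gt_zero subset_iff)
  obtain X where X: "X \<subseteq> P" "\<one> \<in> X" "mult_indicator X \<in> B"
    "mult_indicator X o\<^sub>L (b o\<^sub>L mult_indicator X) \<in> B"
    using cut_down[OF b(1)] by blast
  let ?Q = "mult_indicator X"
  define x where "x = ?Q o\<^sub>L (a o\<^sub>L ?Q)"
  define y0 where "y0 = ?Q o\<^sub>L (b o\<^sub>L ?Q)"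
  have QT: "?Q \<in> T" using X(3) B_subset_T by blast
  have x: "x \<in> I" unfolding x_def by (intro IT QT a)
  have "is_adjoint ((?Q o\<^sub>L a) o\<^sub>L ?Q) x"
    unfolding x_def by (intro is_adjoint_compose mult_indicator_adjoint a(2))
  then have xadj: "is_adjoint x x" by (simp add: x_def blinfun_compose_assoc)
  obtain y1 where y1: "y1 \<in> B" "is_adjoint y1 y0"
    using T_adjoint[of y0] X(4) B_subset_T B_closed(8)[OF X(4)] unfolding y0_def by blast
  \<comment> \<open>The approximant \<open>b\<close> may fail to be self-adjoint, so
    \<open>y0\<close> is replaced by its self-adjoint part; as \<open>x\<close> is self-adjoint,
    this brings it no farther from \<open>x\<close>.\<close>
  define y where "y = (1 / 2) *\<^sub>R (y0 + y1)"
  have "y \<in> B"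
    unfolding y_def by (intro B_closed(3,6) X(4)[folded y0_def] y1(1))
  moreover have "is_adjoint y y"
    using is_adjoint_scaleR[OF is_adjoint_add[OF y1(2) is_adjoint_sym[OF y1(2)]], of "1 / 2"]
    by (simp add: y_def add.commute)
  ultimately have y: "y \<in> B" "is_adjoint y y" by blast+
  have d0: "norm (y0 - x) < c / 2"
  proof -
    have "y0 - x = ?Q o\<^sub>L ((b - a) o\<^sub>L ?Q)" by (simp add: x_def y0_def compose_simps)
    also have "norm \<dots> \<le> norm ?Q * norm ((b - a) o\<^sub>L ?Q)" by (rule norm_blinfun_compose)
    also have "\<dots> \<le> 1 * (norm (b - a) * norm ?Q)"
      by (intro mult_mono norm_mult_indicator norm_blinfun_compose) auto
    also have "\<dots> \<le> norm (b - a)"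
      using norm_mult_indicator[of X] by (simp add: mult_left_le)
    finally show ?thesis using b(2) by simp
  qed
  have "norm (y1 - x) = norm (y0 - x)"
    by (intro is_adjoint_norm is_adjoint_diff y1 xadj)
  moreover have "y - x = (1 / 2) *\<^sub>R ((y0 - x) + (y1 - x))"
    by (simp add: y_def algebra_simps flip: scaleR_add_left)
  then have "norm (y - x) \<le> (1 / 2) * (norm (y0 - x) + norm (y1 - x))"
    using norm_triangle_ineq[of "y0 - x" "y1 - x"] by simp
  ultimately have dist: "norm (y - x) < c / 2" using d0 by simp
  have "c \<le> norm x"
  proof -
    \<comment> \<open>\<open>?Q\<close> fixes \<open>ket \<one>\<close>, so compression preserves
      the value of the form there.\<close>
    have "c = Re (cinner (a (?Q (ket \<one>))) (?Q (ket \<one>)))"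
      using X(2) a(3) by (simp add: mult_indicator_ket)
    also have "\<dots> = Re (cinner (x (ket \<one>)) (ket \<one>))"
      using mult_indicator_adjoint[of X] by (simp add: x_def is_adjoint_def)
    also have "\<dots> \<le> norm (x (ket \<one>)) * norm (ket \<one>)" by (rule Re_cinner_le)
    also have "\<dots> \<le> norm x" using norm_blinfun[of x "ket \<one>"] by (simp add: norm_ket)
    finally show ?thesis .
  qed
  moreover have "norm x \<le> norm y + norm (y - x)"
    using norm_triangle_ineq4[of y "y - x"] by simp
  ultimately have "norm (y - x) < norm y" using dist by linarith
  then show ?thesis
    by (rule ideal_meets_subalgebra[OF cstar_B U_mem(1) B_subset_T I(1) x xadj y])
qed

text \<open>If \<open>\<pi>\<close> is injective on \<open>B\<close>, its kernel in \<open>T\<close>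
  is a closed ideal meeting \<open>B\<close> only in 0, hence is zero.\<close>

lemma faithful_iff:
  fixes \<pi> :: "_ \<Rightarrow> 'h::complex_hilbert_space \<Rightarrow>\<^sub>L 'h"
  assumes \<pi>: "cstar_representation T \<pi>"
  shows "faithful_on T \<pi> \<longleftrightarrow> faithful_on B \<pi>"
proof
  assume "faithful_on T \<pi>"
  then show "faithful_on B \<pi>" using B_subset_T by (rule inj_on_subset)
next
  assume inj: "faithful_on B \<pi>"
  let ?I = "{S \<in> T. \<pi> S = 0}"
  have add: "\<pi> (R + S) = \<pi> R + \<pi> S" if "R \<in> T" "S \<in> T" for R S
    using \<pi> that by (simp add: cstar_representation_def)
  have zero: "\<pi> 0 = 0" using add[of 0 0] T_closed(2) by simp
  have "?I \<inter> B \<subseteq> {0}"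
    using inj B_closed(2) zero by (auto simp: inj_on_def)
  then have ker: "?I = {0}"
    using ideal_meets_units_crossed_product closed_ideal_kernel[OF \<pi> T_adjoint] by blast
  show "faithful_on T \<pi>"
  proof (rule inj_onI)
    fix R S assume RS: "R \<in> T" "S \<in> T" "\<pi> R = \<pi> S"
    have "R - S \<in> T" using RS T_closed(4) by blast
    moreover have "\<pi> (R - S) = 0" using add[OF \<open>R - S \<in> T\<close> RS(2)] RS(3) by simp
    ultimately have "R - S \<in> {0}" using ker by blast
    then show "R = S" by simp
  qed
qed

end

theorem theorem5p1:
  fixes G :: "('g, 'm) monoid_scheme" and P :: "'g set"
  assumes "group G" and "submonoid P G"
  shows "(\<forall>I. closed_ideal (toeplitz_algebra G P) I \<and> I \<noteq> {0} \<longrightarrow>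
      I \<inter> units_crossed_product G P \<noteq> {0}) \<and>
    (\<forall>\<pi> :: ('g ell2 \<Rightarrow>\<^sub>L 'g ell2) \<Rightarrow> ('h::complex_hilbert_space \<Rightarrow>\<^sub>L 'h).
      cstar_representation (toeplitz_algebra G P) \<pi> \<longrightarrow>
      (faithful_on (toeplitz_algebra G P) \<pi> \<longleftrightarrow> faithful_on (units_crossed_product G P) \<pi>))"
proof -
  interpret group_submonoid G P using assms by (rule group_submonoid.intro)
  show ?thesis
    using ideal_meets_units_crossed_product faithful_iff by blast
qed

end
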